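(* Let $X_1,\dots,X_n$ be independent random variables in a sub-linear expectation space $(\Omega,\mathscr{H},\widehat{\mathbb E})$ with upper capacity $\mathbb V$, let $S_k=\sum_{i=1}^kX_i$, and let $c$ be a real constant. (i) Suppose $|X_k|\le c$ for $k=1,\dots,n$, and $\sum_{k=1}^n\widehat{\mathbb E}[X_k^2]>0$. Then for all $x>0$, $$\mathbb V\left(\max_{k\le n}|S_k|>x\right)\ge1-\frac{(x+c)^2+2x\sum_{k=1}^n\big\{(\widehat{\mathbb E}[X_k])^++(\widehat{\mathbb E}[-X_k])^+\big\}}{\sum_{k=1}^n\widehat{\mathbb E}[X_k^2]}.$$ (ii) Suppose $X_k\le c$ and $\widehat{\mathbb E}[X_k]\ge0$ for $k=1,\dots,n$, and $\sum_{k=1}^n\widehat{\mathbb E}[X_k]>0$. Then for all $x>0$, $$\mathbb V\left(\max_{k\le n}S_k>x\right)\ge1-\frac{x+c}{\sum_{k=1}^n\widehat{\mathbb E}[X_k]}.$$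
   Context: Framework. $(\Omega,\mathcal F)$ is a measurable space and $\mathscr{H}$ is a linear space of real ($\mathcal F$-measurable) functions on $\Omega$ such that $X_1,\dots,X_n\in\mathscr{H}$ implies $\varphi(X_1,\dots,X_n)\in\mathscr{H}$ for every $\varphi\in C_{l,Lip}(\mathbb R^n)$, where $C_{l,Lip}(\mathbb R^n)$ is the space of functions $\varphi$ with $|\varphi(x)-\varphi(y)|\le C(1+|x|^m+|y|^m)|x-y|$ for all $x,y\in\mathbb R^n$, for some $C>0$, $m\in\mathbb N$ depending on $\varphi$. Elements of $\mathscr{H}$ are the random variables in the space. A sub-linear expectation on $\mathscr{H}$ is a function $\widehat{\mathbb E}:\mathscr{H}\to[-\infty,\infty]$ such that for all $X,Y\in\mathscr{H}$: (a) $X\ge Y$ implies $\widehat{\mathbb E}[X]\ge\widehat{\mathbb E}[Y]$; (b) $\widehat{\mathbb E}[c]=c$ for constants $c$; (c) $\widehat{\mathbb E}[X+Y]\le\widehat{\mathbb E}[X]+\widehat{\mathbb E}[Y]$ whenever the right side is not of the form $+\infty-\infty$ or $-\infty+\infty$; (d) $\widehat{\mathbb E}[\lambda X]=\lambda\widehat{\mathbb E}[X]$ for $\lambda\ge 0$. The triple $(\Omega,\mathscr{H},\widehat{\mathbb E})$ is called a sub-linear expectation space. Capacity. $\mathbb V(A):=\inf\{\widehat{\mathbb E}[\xi]: I_A\le\xi,\ \xi\in\mathscr{H}\}$ for $A\in\mathcal F$. Independence. Let $C_{b,Lip}$ denote bounded Lipschitz functions. A random vector $Y=(Y_1,\dots,Y_n)$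 ($Y_i\in\mathscr{H}$) is independent to $X=(X_1,\dots,X_m)$ ($X_i\in\mathscr{H}$) if $\widehat{\mathbb E}[\varphi(X,Y)]=\widehat{\mathbb E}\big[\widehat{\mathbb E}[\varphi(x,Y)]|_{x=X}\big]$ for all $\varphi\in C_{b,Lip}(\mathbb R^m\times\mathbb R^n)$. Random variables $X_1,\dots,X_n$ are independent if $X_{i+1}$ is independent to $(X_1,\dots,X_i)$ for each $1\le i<n$. Notation: $a^+=\max(a,0)$. *)

theory Defs
  imports "HOL-Analysis.Analysis"
begin

text \<open>
  A vector of \<open>\<real>\<^sup>n\<close> is a function \<open>x :: nat \<Rightarrow> real\<close> of which only the coordinates
  \<open>x 1, \<dots>, x n\<close> matter; its Euclidean norm is \<open>L2_set x {1..n}\<close>.  The growth and Lipschitz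
  conditions below are imposed for all \<open>x, y :: nat \<Rightarrow> real\<close>.  They force \<open>\<phi> x = \<phi> y\<close> whenever
  \<open>x\<close> and \<open>y\<close> agree on \<open>{1..n}\<close>, so such \<open>\<phi>\<close> are exactly functions on \<open>\<real>\<^sup>n\<close>.
\<close>

definition C_l_Lip :: "nat \<Rightarrow> ((nat \<Rightarrow> real) \<Rightarrow> real) set" where
  "C_l_Lip n = {\<phi>. \<exists>C>0. \<exists>m::nat. \<forall>x y.
     \<bar>\<phi> x - \<phi> y\<bar>
       \<le> C * (1 + L2_set x {1..n} ^ m + L2_set y {1..n} ^ m) * L2_set (\<lambda>i. x i - y i) {1..n}}"

text \<open>Bounded Lipschitz functions on \<open>\<real>\<^sup>m \<times> \<real>\<^sup>n\<close>, in curried form.\<close>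

definition C_b_Lip :: "nat \<Rightarrow> nat \<Rightarrow> ((nat \<Rightarrow> real) \<Rightarrow> (nat \<Rightarrow> real) \<Rightarrow> real) set" where
  "C_b_Lip m n = {\<phi>. (\<exists>B. \<forall>x y. \<bar>\<phi> x y\<bar> \<le> B) \<and>
     (\<exists>C. \<forall>x y x' y'. \<bar>\<phi> x y - \<phi> x' y'\<bar>
        \<le> C * sqrt ((L2_set (\<lambda>i. x i - x' i) {1..m})\<^sup>2 + (L2_set (\<lambda>j. y j - y' j) {1..n})\<^sup>2))}"

text \<open>
  \<open>M\<close> only supplies the measurable space \<open>(\<Omega>, \<F>) = (space M, sets M)\<close>; its measure plays no role.
  Functions on \<open>\<Omega>\<close> are total functions on the type; all pointwise comparisons are restricted to
  \<open>space M\<close>, and by \<open>mono\<close> the value of \<open>E\<close> does not depend on what a function does outside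
  \<open>space M\<close>.
\<close>

locale sublinear_expectation_space =
  fixes M :: "'a measure" and H :: "('a \<Rightarrow> real) set" and E :: "('a \<Rightarrow> real) \<Rightarrow> ereal"
  assumes measurable: "H \<subseteq> borel_measurable M"
    and zero_closed: "(\<lambda>\<omega>. 0) \<in> H"
    and add_closed: "\<And>X Y. X \<in> H \<Longrightarrow> Y \<in> H \<Longrightarrow> (\<lambda>\<omega>. X \<omega> + Y \<omega>) \<in> H"
    and scale_closed: "\<And>a X. X \<in> H \<Longrightarrow> (\<lambda>\<omega>. a * X \<omega>) \<in> H"
    and C_l_Lip_closed: "\<And>n X \<phi>. n \<ge> 1 \<Longrightarrow> (\<And>i. i \<in> {1..n} \<Longrightarrow> X i \<in> H) \<Longrightarrow> \<phi> \<in> C_l_Lip n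
       \<Longrightarrow> (\<lambda>\<omega>. \<phi> (\<lambda>i. X i \<omega>)) \<in> H"
    and mono: "\<And>X Y. X \<in> H \<Longrightarrow> Y \<in> H \<Longrightarrow> (\<And>\<omega>. \<omega> \<in> space M \<Longrightarrow> X \<omega> \<ge> Y \<omega>) \<Longrightarrow> E X \<ge> E Y"
    and const: "\<And>a. E (\<lambda>\<omega>. a) = ereal a"
    and subadd: "\<And>X Y. X \<in> H \<Longrightarrow> Y \<in> H
       \<Longrightarrow> \<not> (E X = \<infinity> \<and> E Y = - \<infinity>) \<Longrightarrow> \<not> (E X = - \<infinity> \<and> E Y = \<infinity>)
       \<Longrightarrow> E (\<lambda>\<omega>. X \<omega> + Y \<omega>) \<le> E X + E Y"
    and pos_homogeneous: "\<And>a X. X \<in> H \<Longrightarrow> a \<ge> 0 \<Longrightarrow> E (\<lambda>\<omega>. a * X \<omega>) = ereal a * E X"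

definition upper_capacity ::
  "'a measure \<Rightarrow> ('a \<Rightarrow> real) set \<Rightarrow> (('a \<Rightarrow> real) \<Rightarrow> ereal) \<Rightarrow> 'a set \<Rightarrow> ereal" where
  "upper_capacity M H E A = Inf {E \<xi> |\<xi>. \<xi> \<in> H \<and> (\<forall>\<omega>\<in>space M. indicator A \<omega> \<le> \<xi> \<omega>)}"

text \<open>
  \<open>indep_vec H E m X n Y\<close>: the random vector \<open>(Y 1, \<dots>, Y n)\<close> is independent to
  \<open>(X 1, \<dots>, X m)\<close>.  For bounded \<open>\<phi>\<close> the inner expectation \<open>E[\<phi>(x, Y)]\<close> is finite by \<open>mono\<close> and
  \<open>const\<close>, so \<open>real_of_ereal\<close> does not change it; it is moreover a bounded Lipschitz function
  of \<open>x\<close>, so that the argument of the outer expectation lies in \<open>H\<close>.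
\<close>

definition indep_vec ::
  "('a \<Rightarrow> real) set \<Rightarrow> (('a \<Rightarrow> real) \<Rightarrow> ereal) \<Rightarrow> nat \<Rightarrow> (nat \<Rightarrow> 'a \<Rightarrow> real) \<Rightarrow> nat \<Rightarrow> (nat \<Rightarrow> 'a \<Rightarrow> real) \<Rightarrow> bool"
  where
  "indep_vec H E m X n Y \<longleftrightarrow>
     (\<forall>i\<in>{1..m}. X i \<in> H) \<and> (\<forall>j\<in>{1..n}. Y j \<in> H) \<and>
     (\<forall>\<phi>\<in>C_b_Lip m n.
        E (\<lambda>\<omega>. \<phi> (\<lambda>i. X i \<omega>) (\<lambda>j. Y j \<omega>)) =
        E (\<lambda>\<omega>. real_of_ereal (E (\<lambda>\<omega>'. \<phi> (\<lambda>i. X i \<omega>) (\<lambda>j. Y j \<omega>')))))"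

definition indep_rvs ::
  "('a \<Rightarrow> real) set \<Rightarrow> (('a \<Rightarrow> real) \<Rightarrow> ereal) \<Rightarrow> nat \<Rightarrow> (nat \<Rightarrow> 'a \<Rightarrow> real) \<Rightarrow> bool" where
  "indep_rvs H E n X \<longleftrightarrow>
     (\<forall>i\<in>{1..n}. X i \<in> H) \<and>
     (\<forall>i. 1 \<le> i \<and> i < n \<longrightarrow> indep_vec H E i X 1 (\<lambda>_. X (Suc i)))"

end

theory Submission
  imports Defs
begin

text \<open>
  Both parts are Kolmogorov's converse maximal inequality, proved by stopping the walk \<open>S\<close> when
  \<open>\<bar>S\<bar>\<close> (two-sided case) or \<open>S\<close> (one-sided case) exceeds \<open>x\<close>.  As independence is available
  for Lipschitz functions only, the indicator of the region in which the walk goes on is replaced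
  by a Lipschitz gate \<open>f\<close>, equal to \<open>1\<close> up to the level \<open>x\<close> and
  to \<open>0\<close> from a level \<open>y > x\<close> on, and the event that the walk is still running at time \<open>k\<close> by
  \<open>\<eta>\<^sub>k = f (S\<^sub>0) \<cdots> f (S\<^sub>k)\<close>.  Take \<open>u s = s\<^sup>2\<close> in the two-sided case and \<open>u s = s\<close> in the
  one-sided case, and let \<open>p\<^sub>k - r\<^sub>k\<close>, with \<open>p\<^sub>k, r\<^sub>k \<ge> 0\<close>, be a lower bound for
  \<open>E[u (s + X\<^sub>k\<^sub>+\<^sub>1) - u s]\<close> as long as \<open>f s \<noteq> 0\<close>.  Consider
  \<open>F = \<Sum>k<n. \<eta>\<^sub>k * (u (S\<^sub>k\<^sub>+\<^sub>1) - u (S\<^sub>k) - (p\<^sub>k - r\<^sub>k))\<close>.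

  Two facts about \<open>F\<close> give the result (\<open>capacity_ge_of_gate\<close>).  Conditioning on the past, one
  variable at a time (\<open>E_le_by_conditioning\<close>), shows \<open>E[F] \<ge> 0\<close>.  On the other hand summation by
  parts (\<open>stopped_increments_le\<close>) bounds the sum of the stopped increments of \<open>u\<close> by the largest value
  \<open>U\<close> that \<open>u\<close> can take one step after the gate was open.  A function \<open>\<xi>\<close> that dominates the indicator
  of the exit event satisfies \<open>\<eta>\<^sub>k \<ge> \<eta>\<^sub>n \<ge> 1 - \<xi>\<close>, whence
  \<open>F \<le> U + \<Sum> r\<^sub>k - (1 - \<xi>) \<Sum> p\<^sub>k\<close>, and taking expectations
  \<open>E[\<xi>] \<ge> 1 - (U + \<Sum> r\<^sub>k) / \<Sum> p\<^sub>k\<close>.  The infimum over \<open>\<xi>\<close> is the capacity, and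
  \<open>y\<close> decreases to \<open>x\<close> at the end.

  In the two-sided case \<open>U = (y + c)\<^sup>2\<close>, \<open>p\<^sub>k = E[X\<^sub>k\<^sub>+\<^sub>1\<^sup>2]\<close>, and \<open>r\<^sub>k\<close> pays for the cross term
  \<open>2 s X\<^sub>k\<^sub>+\<^sub>1\<close>, whose coefficient is at most \<open>2 y\<close> in absolute value.  In the one-sided case
  \<open>U = y + c\<close>, \<open>p\<^sub>k = E[X\<^sub>k\<^sub>+\<^sub>1]\<close> and \<open>r\<^sub>k = 0\<close>.  The variables may be unbounded below there,
  but truncating them at \<open>- n c\<close> can only increase their expectations, without changing the event: a walk of
  \<open>n\<close> steps with a step of \<open>- n c\<close> or below cannot be positive after it.
\<close>

section \<open>Truncation and the Lipschitz classes\<close>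

definition clip :: "real \<Rightarrow> real \<Rightarrow> real \<Rightarrow> real" where
  "clip a b t = max a (min b t)"

lemma clip_lipschitz: "\<bar>clip a b s - clip a b t\<bar> \<le> \<bar>s - t\<bar>"
  unfolding clip_def by linarith

lemma abs_clip_le: "K \<ge> 0 \<Longrightarrow> \<bar>clip (- K) K t\<bar> \<le> K"
  unfolding clip_def by linarith

lemma clip_eq_if_abs_le: "\<bar>t\<bar> \<le> K \<Longrightarrow> clip (- K) K t = t"
  unfolding clip_def by linarith

lemma sum_abs_le_L2_set: "(\<Sum>i=1..k. \<bar>z i\<bar>) \<le> real k * L2_set z {1..k}"
proof -
  have "\<bar>z i\<bar> \<le> L2_set z {1..k}" if "i \<in> {1..k}" for i
    using member_le_L2_set[of "{1..k}" i "\<lambda>i. \<bar>z i\<bar>"] that by (simp add: L2_set_def)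
  then show ?thesis
    using sum_bounded_above[of "{1..k}" "\<lambda>i. \<bar>z i\<bar>" "L2_set z {1..k}"] by simp
qed

text \<open>
  The two classes of test functions are stated with Euclidean norms.  All estimates below use the
  \<open>l\<^sup>1\<close> norm instead, which is additive in the coordinates; the two norms are equivalent.
\<close>

lemma C_l_Lip_if_lipschitz:
  assumes "C \<ge> 0" and "\<And>x y. \<bar>\<phi> x - \<phi> y\<bar> \<le> C * (\<Sum>i=1..k. \<bar>x i - y i\<bar>)"
  shows "\<phi> \<in> C_l_Lip k"
proof -
  have "\<bar>\<phi> x - \<phi> y\<bar> \<le> (C * real k + 1) * (1 + L2_set x {1..k} ^ 0 + L2_set y {1..k} ^ 0)
      * L2_set (\<lambda>i. x i - y i) {1..k}" for x y
  proof -
    let ?L = "L2_set (\<lambda>i. x i - y i) {1..k}"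
    have "\<bar>\<phi> x - \<phi> y\<bar> \<le> C * (real k * ?L)"
      using assms(2)[of x y] mult_left_mono[OF sum_abs_le_L2_set[of "\<lambda>i. x i - y i" k] assms(1)]
      by linarith
    also have "\<dots> \<le> (C * real k + 1) * 3 * ?L"
    proof -
      have "0 \<le> (2 * (C * real k) + 3) * ?L" using assms(1) by (simp add: L2_set_nonneg)
      then show ?thesis by (simp add: algebra_simps)
    qed
    finally show ?thesis by simp
  qed
  moreover have "C * real k + 1 > 0" using assms(1) by (simp add: add_nonneg_pos)
  ultimately show ?thesis unfolding C_l_Lip_def by blast
qed

lemma C_b_Lip_if_lipschitz:
  assumes "C \<ge> 0" and "\<And>x y. \<bar>\<phi> x y\<bar> \<le> B"
    and "\<And>x y x' y'. \<bar>\<phi> x y - \<phi> x' y'\<bar>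
      \<le> C * ((\<Sum>i=1..m. \<bar>x i - x' i\<bar>) + (\<Sum>j=1..n. \<bar>y j - y' j\<bar>))"
  shows "\<phi> \<in> C_b_Lip m n"
proof -
  have "\<bar>\<phi> x y - \<phi> x' y'\<bar> \<le> (C * (real m + real n))
      * sqrt ((L2_set (\<lambda>i. x i - x' i) {1..m})\<^sup>2 + (L2_set (\<lambda>j. y j - y' j) {1..n})\<^sup>2)"
    (is "_ \<le> _ * sqrt (?a\<^sup>2 + ?b\<^sup>2)") for x y x' y'
  proof -
    let ?r = "sqrt (?a\<^sup>2 + ?b\<^sup>2)"
    have a: "?a \<le> ?r" by (rule real_sqrt_sum_squares_ge1)
    have b: "?b \<le> ?r" by (rule real_sqrt_sum_squares_ge2)
    have "(\<Sum>i=1..m. \<bar>x i - x' i\<bar>) + (\<Sum>j=1..n. \<bar>y j - y' j\<bar>) \<le> real m * ?a + real n * ?b"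
      by (intro add_mono sum_abs_le_L2_set)
    also have "\<dots> \<le> real m * ?r + real n * ?r"
      by (intro add_mono mult_left_mono a b) auto
    finally have "C * ((\<Sum>i=1..m. \<bar>x i - x' i\<bar>) + (\<Sum>j=1..n. \<bar>y j - y' j\<bar>))
        \<le> C * (real m * ?r + real n * ?r)"
      using assms(1) by (rule mult_left_mono)
    then show ?thesis using assms(3)[of x y x' y'] by (simp add: algebra_simps)
  qed
  then show ?thesis unfolding C_b_Lip_def using assms(2) by blast
qed

section \<open>Lipschitz functions on a box\<close>

text \<open>
  The test functions of the proof are polynomials in the \<open>X\<^sub>i\<close> and in gates of partial sums.  They are
  in general neither bounded nor Lipschitz on the whole space, but they are Lipschitz on the cube
  \<open>[-K, K]\<^sup>k\<close> that contains the values of bounded variables, and on a cube this property is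
  stable under products.  It also forces \<open>f x\<close>, for \<open>x\<close> in the cube, to depend on the coordinates
  \<open>1, \<dots>, k\<close> only.
\<close>

definition lipschitz_on_box :: "real \<Rightarrow> nat \<Rightarrow> ((nat \<Rightarrow> real) \<Rightarrow> real) \<Rightarrow> bool" where
  "lipschitz_on_box K k f \<longleftrightarrow> (\<exists>C\<ge>0. \<forall>x y. (\<forall>i\<in>{1..k}. \<bar>x i\<bar> \<le> K \<and> \<bar>y i\<bar> \<le> K) \<longrightarrow>
     \<bar>f x - f y\<bar> \<le> C * (\<Sum>i=1..k. \<bar>x i - y i\<bar>))"

lemma lipschitz_on_boxE:
  assumes "lipschitz_on_box K k f"
  obtains C where "C \<ge> 0"
    and "\<And>x y. (\<forall>i\<in>{1..k}. \<bar>x i\<bar> \<le> K \<and> \<bar>y i\<bar> \<le> K) \<Longrightarrow>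
      \<bar>f x - f y\<bar> \<le> C * (\<Sum>i=1..k. \<bar>x i - y i\<bar>)"
  using assms that unfolding lipschitz_on_box_def by (elim exE conjE) simp

lemma lipschitz_on_box_cong:
  assumes "lipschitz_on_box K k f" and "\<forall>i\<in>{1..k}. \<bar>x i\<bar> \<le> K" and "\<forall>i\<in>{1..k}. x i = y i"
  shows "f x = f y"
proof -
  obtain C where "\<bar>f x - f y\<bar> \<le> C * (\<Sum>i=1..k. \<bar>x i - y i\<bar>)"
    using assms unfolding lipschitz_on_box_def by metis
  moreover have "(\<Sum>i=1..k. \<bar>x i - y i\<bar>) = 0" using assms(3) by (intro sum.neutral) auto
  ultimately show ?thesis by simp
qed

lemma lipschitz_on_box_bounded:
  assumes "lipschitz_on_box K k f" and "K \<ge> 0"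
  shows "\<exists>B\<ge>0. \<forall>x. (\<forall>i\<in>{1..k}. \<bar>x i\<bar> \<le> K) \<longrightarrow> \<bar>f x\<bar> \<le> B"
proof -
  obtain C where C: "C \<ge> 0" "\<And>x y. (\<forall>i\<in>{1..k}. \<bar>x i\<bar> \<le> K \<and> \<bar>y i\<bar> \<le> K) \<Longrightarrow>
     \<bar>f x - f y\<bar> \<le> C * (\<Sum>i=1..k. \<bar>x i - y i\<bar>)"
    using lipschitz_on_boxE[OF assms(1)] by blast
  have "\<bar>f x\<bar> \<le> \<bar>f (\<lambda>_. 0)\<bar> + C * (real k * K)" if x: "\<forall>i\<in>{1..k}. \<bar>x i\<bar> \<le> K" for x
  proof -
    have "\<bar>f x - f (\<lambda>_. 0)\<bar> \<le> C * (\<Sum>i=1..k. \<bar>x i - 0\<bar>)"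
      using C(2)[of x "\<lambda>_. 0"] x assms(2) by simp
    also have "\<dots> \<le> C * (real k * K)"
      using sum_bounded_above[of "{1..k}" "\<lambda>i. \<bar>x i - 0\<bar>" K] x C(1)
      by (intro mult_left_mono) auto
    finally show ?thesis by linarith
  qed
  moreover have "0 \<le> \<bar>f (\<lambda>_. 0)\<bar> + C * (real k * K)" using C(1) assms(2) by simp
  ultimately show ?thesis by blast
qed

lemma lipschitz_on_box_const: "lipschitz_on_box K k (\<lambda>_. a)"
  unfolding lipschitz_on_box_def by (intro exI[of _ 0]) auto

lemma lipschitz_on_box_weaken:
  assumes "lipschitz_on_box K j f" and "j \<le> k"
  shows "lipschitz_on_box K k f"
proof -
  obtain C where C: "C \<ge> 0" "\<And>x y. (\<forall>i\<in>{1..j}. \<bar>x i\<bar> \<le> K \<and> \<bar>y i\<bar> \<le> K) \<Longrightarrow>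
     \<bar>f x - f y\<bar> \<le> C * (\<Sum>i=1..j. \<bar>x i - y i\<bar>)"
    using lipschitz_on_boxE[OF assms(1)] by blast
  have "\<bar>f x - f y\<bar> \<le> C * (\<Sum>i=1..k. \<bar>x i - y i\<bar>)"
    if "\<forall>i\<in>{1..k}. \<bar>x i\<bar> \<le> K \<and> \<bar>y i\<bar> \<le> K" for x y
  proof -
    have "\<bar>f x - f y\<bar> \<le> C * (\<Sum>i=1..j. \<bar>x i - y i\<bar>)" using C(2) that assms(2) by auto
    also have "\<dots> \<le> C * (\<Sum>i=1..k. \<bar>x i - y i\<bar>)"
      using assms(2) C(1) by (intro mult_left_mono sum_mono2) auto
    finally show ?thesis .
  qed
  then show ?thesis unfolding lipschitz_on_box_def using C(1) by blast
qed

lemma lipschitz_on_box_add: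
  assumes "lipschitz_on_box K k f" and "lipschitz_on_box K k g"
  shows "lipschitz_on_box K k (\<lambda>x. f x + g x)"
proof -
  obtain C where C: "C \<ge> 0" "\<And>x y. (\<forall>i\<in>{1..k}. \<bar>x i\<bar> \<le> K \<and> \<bar>y i\<bar> \<le> K) \<Longrightarrow>
     \<bar>f x - f y\<bar> \<le> C * (\<Sum>i=1..k. \<bar>x i - y i\<bar>)"
    using lipschitz_on_boxE[OF assms(1)] by blast
  obtain D where D: "D \<ge> 0" "\<And>x y. (\<forall>i\<in>{1..k}. \<bar>x i\<bar> \<le> K \<and> \<bar>y i\<bar> \<le> K) \<Longrightarrow>
     \<bar>g x - g y\<bar> \<le> D * (\<Sum>i=1..k. \<bar>x i - y i\<bar>)"
    using lipschitz_on_boxE[OF assms(2)] by blast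
  have "\<bar>f x + g x - (f y + g y)\<bar> \<le> (C + D) * (\<Sum>i=1..k. \<bar>x i - y i\<bar>)"
    if "\<forall>i\<in>{1..k}. \<bar>x i\<bar> \<le> K \<and> \<bar>y i\<bar> \<le> K" for x y
    using C(2)[OF that] D(2)[OF that] unfolding distrib_right by linarith
  then show ?thesis unfolding lipschitz_on_box_def using C(1) D(1)
    by (intro exI[of _ "C + D"]) auto
qed

lemma lipschitz_on_box_mult:
  assumes "lipschitz_on_box K k f" and "lipschitz_on_box K k g" and "K \<ge> 0"
  shows "lipschitz_on_box K k (\<lambda>x. f x * g x)"
proof -
  obtain C where C: "C \<ge> 0" "\<And>x y. (\<forall>i\<in>{1..k}. \<bar>x i\<bar> \<le> K \<and> \<bar>y i\<bar> \<le> K) \<Longrightarrow>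
     \<bar>f x - f y\<bar> \<le> C * (\<Sum>i=1..k. \<bar>x i - y i\<bar>)"
    using lipschitz_on_boxE[OF assms(1)] by blast
  obtain D where D: "D \<ge> 0" "\<And>x y. (\<forall>i\<in>{1..k}. \<bar>x i\<bar> \<le> K \<and> \<bar>y i\<bar> \<le> K) \<Longrightarrow>
     \<bar>g x - g y\<bar> \<le> D * (\<Sum>i=1..k. \<bar>x i - y i\<bar>)"
    using lipschitz_on_boxE[OF assms(2)] by blast
  obtain A where A: "A \<ge> 0" "\<And>x. (\<forall>i\<in>{1..k}. \<bar>x i\<bar> \<le> K) \<Longrightarrow> \<bar>f x\<bar> \<le> A"
    using lipschitz_on_box_bounded[OF assms(1,3)] by blast
  obtain B where B: "B \<ge> 0" "\<And>x. (\<forall>i\<in>{1..k}. \<bar>x i\<bar> \<le> K) \<Longrightarrow> \<bar>g x\<bar> \<le> B"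
    using lipschitz_on_box_bounded[OF assms(2,3)] by blast
  have "\<bar>f x * g x - f y * g y\<bar> \<le> (A * D + B * C) * (\<Sum>i=1..k. \<bar>x i - y i\<bar>)"
    if xy: "\<forall>i\<in>{1..k}. \<bar>x i\<bar> \<le> K \<and> \<bar>y i\<bar> \<le> K" for x y
  proof -
    let ?d = "\<Sum>i=1..k. \<bar>x i - y i\<bar>"
    have "\<bar>f x * g x - f y * g y\<bar> = \<bar>f x * (g x - g y) + g y * (f x - f y)\<bar>"
      by (simp add: algebra_simps)
    also have "\<dots> \<le> \<bar>f x\<bar> * \<bar>g x - g y\<bar> + \<bar>g y\<bar> * \<bar>f x - f y\<bar>"
      by (metis abs_mult abs_triangle_ineq)
    also have "\<dots> \<le> A * (D * ?d) + B * (C * ?d)"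
      using A B C(2)[OF xy] D(2)[OF xy] xy by (intro add_mono mult_mono) auto
    finally show ?thesis by (simp add: algebra_simps)
  qed
  then show ?thesis unfolding lipschitz_on_box_def using A B C(1) D(1)
    by (intro exI[of _ "A * D + B * C"]) auto
qed

lemma lipschitz_on_box_sum:
  assumes "finite I" and "\<And>j. j \<in> I \<Longrightarrow> lipschitz_on_box K k (f j)"
  shows "lipschitz_on_box K k (\<lambda>x. \<Sum>j\<in>I. f j x)"
  using assms by (induction I) (auto intro: lipschitz_on_box_const lipschitz_on_box_add)

lemma lipschitz_on_box_prod:
  assumes "finite I" and "\<And>j. j \<in> I \<Longrightarrow> lipschitz_on_box K k (f j)" and "K \<ge> 0"
  shows "lipschitz_on_box K k (\<lambda>x. \<Prod>j\<in>I. f j x)"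
  using assms by (induction I) (auto intro: lipschitz_on_box_const lipschitz_on_box_mult)

lemma abs_sum_le_box:
  assumes "\<forall>i\<in>{1..k}. \<bar>x i\<bar> \<le> (K::real)"
  shows "\<bar>\<Sum>i=1..k. x i\<bar> \<le> real k * K"
proof -
  have "\<bar>\<Sum>i=1..k. x i\<bar> \<le> (\<Sum>i=1..k. \<bar>x i\<bar>)" by (rule sum_abs)
  also have "\<dots> \<le> real k * K" using sum_bounded_above[of "{1..k}" "\<lambda>i. \<bar>x i\<bar>" K] assms by simp
  finally show ?thesis .
qed

lemma lipschitz_on_box_partial_sum:
  assumes u: "C-lipschitz_on {- (real k * K)..real k * K} u"
  shows "lipschitz_on_box K k (\<lambda>x. u (\<Sum>i=1..k. x i))"
proof -
  have "\<bar>u (\<Sum>i=1..k. x i) - u (\<Sum>i=1..k. y i)\<bar> \<le> C * (\<Sum>i=1..k. \<bar>x i - y i\<bar>)"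
    if xy: "\<forall>i\<in>{1..k}. \<bar>x i\<bar> \<le> K \<and> \<bar>y i\<bar> \<le> K" for x y
  proof -
    have "\<bar>\<Sum>i=1..k. x i\<bar> \<le> real k * K" "\<bar>\<Sum>i=1..k. y i\<bar> \<le> real k * K"
      using xy abs_sum_le_box[of k x K] abs_sum_le_box[of k y K] by blast+
    then have "\<bar>u (\<Sum>i=1..k. x i) - u (\<Sum>i=1..k. y i)\<bar> \<le> C * \<bar>(\<Sum>i=1..k. x i) - (\<Sum>i=1..k. y i)\<bar>"
      using lipschitz_onD[OF u] by (auto simp: dist_real_def abs_le_iff)
    also have "\<dots> = C * \<bar>\<Sum>i=1..k. x i - y i\<bar>" by (simp add: sum_subtractf)
    also have "\<dots> \<le> C * (\<Sum>i=1..k. \<bar>x i - y i\<bar>)"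
      by (intro mult_left_mono sum_abs lipschitz_on_nonneg[OF u])
    finally show ?thesis .
  qed
  then show ?thesis unfolding lipschitz_on_box_def using lipschitz_on_nonneg[OF u] by blast
qed

text \<open>
  Composition with the truncation of every coordinate turns a function of this kind into a globally
  bounded Lipschitz function that agrees with it on the cube.  This is how such functions become
  admissible in the definition of independence.
\<close>

lemma lipschitz_on_box_clip:
  assumes f: "lipschitz_on_box K k f" and K: "K \<ge> 0"
  obtains C B where "C \<ge> 0" and "\<And>x. \<bar>f (\<lambda>i. clip (-K) K (x i))\<bar> \<le> B"
    and "\<And>x y. \<bar>f (\<lambda>i. clip (-K) K (x i)) - f (\<lambda>i. clip (-K) K (y i))\<bar>
      \<le> C * (\<Sum>i=1..k. \<bar>x i - y i\<bar>)"
proof -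
  have box: "\<forall>i\<in>{1..k}. \<bar>clip (-K) K (x i)\<bar> \<le> K" for x
    using abs_clip_le[OF K] by blast
  obtain B where B: "\<And>x. \<bar>f (\<lambda>i. clip (-K) K (x i))\<bar> \<le> B"
    using lipschitz_on_box_bounded[OF f K] box by metis
  obtain C where C: "C \<ge> 0" "\<And>x y. (\<forall>i\<in>{1..k}. \<bar>x i\<bar> \<le> K \<and> \<bar>y i\<bar> \<le> K) \<Longrightarrow>
     \<bar>f x - f y\<bar> \<le> C * (\<Sum>i=1..k. \<bar>x i - y i\<bar>)"
    using lipschitz_on_boxE[OF f] by blast
  have "\<bar>f (\<lambda>i. clip (-K) K (x i)) - f (\<lambda>i. clip (-K) K (y i))\<bar>
      \<le> C * (\<Sum>i=1..k. \<bar>x i - y i\<bar>)" for x y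
  proof -
    have "\<bar>f (\<lambda>i. clip (-K) K (x i)) - f (\<lambda>i. clip (-K) K (y i))\<bar>
      \<le> C * (\<Sum>i=1..k. \<bar>clip (-K) K (x i) - clip (-K) K (y i)\<bar>)"
      using box by (intro C(2)) auto
    also have "\<dots> \<le> C * (\<Sum>i=1..k. \<bar>x i - y i\<bar>)"
      using C(1) by (intro mult_left_mono sum_mono clip_lipschitz) auto
    finally show ?thesis .
  qed
  then show ?thesis using that[OF C(1)] B by blast
qed

section \<open>Summation by parts\<close>

text \<open>
  Summation by parts gives
  \<open>(\<Sum>k<n. \<eta>\<^sub>k * (v\<^sub>k\<^sub>+\<^sub>1 - v\<^sub>k)) = \<eta>\<^sub>n * v\<^sub>n + (\<Sum>k<n. (\<eta>\<^sub>k - \<eta>\<^sub>k\<^sub>+\<^sub>1) * v\<^sub>k\<^sub>+\<^sub>1)\<close>.  The weights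
  \<open>\<eta>\<^sub>n\<close> and \<open>\<eta>\<^sub>k - \<eta>\<^sub>k\<^sub>+\<^sub>1\<close> are nonnegative with sum \<open>1\<close>, so the right side is an
  average of values of \<open>v\<close>, and each value with nonzero weight is at most \<open>U\<close>.
\<close>

lemma stopped_increments_le:
  fixes \<eta> v :: "nat \<Rightarrow> real"
  assumes "\<eta> 0 = 1" "v 0 = 0" "n \<ge> 1" and nonneg: "\<And>k. \<eta> k \<ge> 0"
    and dec: "\<And>k. \<eta> (Suc k) \<le> \<eta> k"
    and U: "\<And>k. k < n \<Longrightarrow> \<eta> k \<noteq> 0 \<Longrightarrow> v (Suc k) \<le> U"
  shows "(\<Sum>k<n. \<eta> k * (v (Suc k) - v k)) \<le> U"
proof -
  have "m \<le> n \<Longrightarrow> (\<Sum>k<m. \<eta> k * (v (Suc k) - v k)) \<le> U * (1 - \<eta> m) + \<eta> m * v m" for m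
  proof (induction m)
    case 0
    then show ?case using assms by simp
  next
    case (Suc m)
    have "(\<eta> m - \<eta> (Suc m)) * v (Suc m) \<le> (\<eta> m - \<eta> (Suc m)) * U"
    proof (cases "\<eta> m = 0")
      case True
      then have "\<eta> (Suc m) = 0" using dec[of m] nonneg[of "Suc m"] by simp
      then show ?thesis using True by simp
    next
      case False
      then show ?thesis using U[of m] Suc.prems dec[of m] by (intro mult_left_mono) auto
    qed
    then show ?case using Suc by (simp add: algebra_simps)
  qed
  from this[of n] have "(\<Sum>k<n. \<eta> k * (v (Suc k) - v k)) \<le> U * (1 - \<eta> n) + \<eta> n * v n" by simp
  also have "\<dots> \<le> U"
  proof -
    obtain m where m: "n = Suc m" using assms(3) by (cases n) auto
    have "\<eta> n * v n \<le> \<eta> n * U"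
    proof (cases "\<eta> n = 0")
      case False
      then have "\<eta> m \<noteq> 0" using dec[of m] nonneg[of n] m by auto
      then show ?thesis using U[of m] m nonneg by (intro mult_left_mono) auto
    qed simp
    then show ?thesis by (simp add: algebra_simps)
  qed
  finally show ?thesis .
qed

section \<open>Sub-linear expectations and conditioning\<close>

context sublinear_expectation_space
begin

lemma lipschitz_closed:
  fixes k :: nat
  assumes "k \<ge> 1" and "\<And>i. i \<in> {1..k} \<Longrightarrow> X i \<in> H" and "C \<ge> 0"
    and "\<And>x y. \<bar>\<phi> x - \<phi> y\<bar> \<le> C * (\<Sum>i=1..k. \<bar>x i - y i\<bar>)"
  shows "(\<lambda>\<omega>. \<phi> (\<lambda>i. X i \<omega>)) \<in> H"
  by (rule C_l_Lip_closed[OF assms(1,2) C_l_Lip_if_lipschitz[OF assms(3,4)]])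

lemma const_closed: "(\<lambda>\<omega>. a) \<in> H"
  using lipschitz_closed[of 1 "\<lambda>_ _. 0" 0 "\<lambda>_. a"] zero_closed by simp

lemma clip_closed: "Y \<in> H \<Longrightarrow> (\<lambda>\<omega>. clip a b (Y \<omega>)) \<in> H"
  using lipschitz_closed[of 1 "\<lambda>_. Y" 1 "\<lambda>x. clip a b (x 1)"] clip_lipschitz by simp

lemma uminus_closed: "Y \<in> H \<Longrightarrow> (\<lambda>\<omega>. - Y \<omega>) \<in> H"
  using scale_closed[of Y "-1"] by simp

lemma square_closed:
  assumes "Y \<in> H" shows "(\<lambda>\<omega>. (Y \<omega>)\<^sup>2) \<in> H"
proof -
  have "\<bar>(x 1)\<^sup>2 - (y 1)\<^sup>2\<bar> \<le> 1 * (1 + L2_set x {1..1} ^ 1 + L2_set y {1..1} ^ 1)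
      * L2_set (\<lambda>i. x i - y i) {1..1}" for x y :: "nat \<Rightarrow> real"
  proof -
    have "\<bar>(x 1)\<^sup>2 - (y 1)\<^sup>2\<bar> = \<bar>x 1 + y 1\<bar> * \<bar>x 1 - y 1\<bar>"
      unfolding abs_mult[symmetric] by (simp add: power2_eq_square algebra_simps)
    also have "\<dots> \<le> (1 + \<bar>x 1\<bar> + \<bar>y 1\<bar>) * \<bar>x 1 - y 1\<bar>"
      by (intro mult_right_mono) auto
    finally show ?thesis by simp
  qed
  then have "(\<lambda>x. (x 1)\<^sup>2) \<in> C_l_Lip 1" unfolding C_l_Lip_def using zero_less_one by blast
  from C_l_Lip_closed[OF _ _ this, of "\<lambda>_. Y"] assms show ?thesis by simp
qed

lemma lipschitz_on_box_closed:
  assumes f: "lipschitz_on_box K k f" and K: "K \<ge> 0"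
    and H: "\<And>i. i \<in> {1..k} \<Longrightarrow> X i \<in> H" and bd: "\<And>i \<omega>. i \<in> {1..k} \<Longrightarrow> \<bar>X i \<omega>\<bar> \<le> K"
  shows "(\<lambda>\<omega>. f (\<lambda>i. X i \<omega>)) \<in> H"
proof (cases "k = 0")
  case True
  then have "f (\<lambda>i. X i \<omega>) = f (\<lambda>_. 0)" for \<omega>
    using lipschitz_on_box_cong[OF f] by simp
  then show ?thesis by (simp add: const_closed)
next
  case False
  obtain C B where *: "C \<ge> 0" and "\<And>x. \<bar>f (\<lambda>i. clip (-K) K (x i))\<bar> \<le> B"
    and **: "\<And>x y. \<bar>f (\<lambda>i. clip (-K) K (x i)) - f (\<lambda>i. clip (-K) K (y i))\<bar>
      \<le> C * (\<Sum>i=1..k. \<bar>x i - y i\<bar>)"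
    by (rule lipschitz_on_box_clip[OF f K]) (rule that, assumption+)
  have "f (\<lambda>i. clip (-K) K (X i \<omega>)) = f (\<lambda>i. X i \<omega>)" for \<omega>
    by (rule lipschitz_on_box_cong[OF f, symmetric]) (use bd in \<open>simp_all add: clip_eq_if_abs_le\<close>)
  moreover have "(\<lambda>\<omega>. f (\<lambda>i. clip (-K) K (X i \<omega>))) \<in> H"
    by (rule lipschitz_closed[of k X, OF _ H * **]) (use False in simp_all)
  ultimately show ?thesis by simp
qed

lemma space_nonempty: "space M \<noteq> {}"
proof
  assume "space M = {}"
  then have "E (\<lambda>\<omega>. 0) \<ge> E (\<lambda>\<omega>. 1)" by (intro mono const_closed) auto
  then show False by (simp add: const)
qed

text \<open>
  This is what makes it possible to replace the variables, which are bounded on \<open>space M\<close>, by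
  truncations that are bounded on the whole type and are equal to them on \<open>space M\<close>.
\<close>

lemma E_cong:
  assumes "Y \<in> H" "Z \<in> H" "\<And>\<omega>. \<omega> \<in> space M \<Longrightarrow> Y \<omega> = Z \<omega>"
  shows "E Y = E Z"
  using assms by (intro antisym mono) auto

lemma E_le_const: "Y \<in> H \<Longrightarrow> (\<And>\<omega>. \<omega> \<in> space M \<Longrightarrow> Y \<omega> \<le> b) \<Longrightarrow> E Y \<le> ereal b"
  using mono[of "\<lambda>_. b" Y] by (simp add: const_closed const)

lemma E_ge_const: "Y \<in> H \<Longrightarrow> (\<And>\<omega>. \<omega> \<in> space M \<Longrightarrow> a \<le> Y \<omega>) \<Longrightarrow> ereal a \<le> E Y"
  using mono[of Y "\<lambda>_. a"] by (simp add: const_closed const)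

lemma E_finite:
  assumes "Y \<in> H" "\<And>\<omega>. \<omega> \<in> space M \<Longrightarrow> \<bar>Y \<omega>\<bar> \<le> B"
  shows "ereal (real_of_ereal (E Y)) = E Y"
proof -
  have "ereal (-B) \<le> E Y" by (rule E_ge_const) (use assms in \<open>auto simp: abs_le_iff intro: minus_le_iff[THEN iffD1]\<close>)
  moreover have "E Y \<le> ereal B" by (rule E_le_const) (use assms in \<open>auto simp: abs_le_iff\<close>)
  ultimately show ?thesis by (cases "E Y") auto
qed

lemma E_add_const_le:
  assumes "Y \<in> H" shows "E (\<lambda>\<omega>. a + Y \<omega>) \<le> ereal a + E Y"
  using subadd[OF const_closed[of a] assms] by (simp add: const)

text \<open>
  Subadditivity bounds expectations of sums from above.  Moving the constant \<open>a\<close> to the other side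
  gives a bound from below, since constants are the terms for which \<open>E\<close> is additive.
\<close>

lemma E_affine_ge:
  assumes "Y \<in> H" "b \<ge> 0" "ereal d \<le> E Y"
  shows "ereal (a + b * d) \<le> E (\<lambda>\<omega>. a + b * Y \<omega>)"
proof -
  have "E (\<lambda>\<omega>. b * Y \<omega>) = E (\<lambda>\<omega>. - a + (a + b * Y \<omega>))" by simp
  also have "\<dots> \<le> ereal (- a) + E (\<lambda>\<omega>. a + b * Y \<omega>)"
    by (rule E_add_const_le) (intro add_closed const_closed scale_closed assms)
  finally have "ereal b * E Y \<le> ereal (- a) + E (\<lambda>\<omega>. a + b * Y \<omega>)"
    using pos_homogeneous assms by simp
  moreover have "ereal (b * d) \<le> ereal b * E Y"
    using ereal_mult_left_mono[OF assms(3), of "ereal b"] assms(2) by simp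
  ultimately have "ereal (b * d) \<le> ereal (- a) + E (\<lambda>\<omega>. a + b * Y \<omega>)" by (rule order_trans[rotated])
  then show ?thesis by (cases "E (\<lambda>\<omega>. a + b * Y \<omega>)") auto
qed

text \<open>
  A bounded Lipschitz test function of the truncated variables is one of the original variables.
\<close>

lemma indep_rvs_clip:
  assumes "indep_rvs H E n X"
  shows "indep_rvs H E n (\<lambda>k \<omega>. clip a b (X k \<omega>))"
proof -
  have "indep_vec H E i (\<lambda>k \<omega>. clip a b (X k \<omega>)) 1 (\<lambda>_ \<omega>. clip a b (X (Suc i) \<omega>))"
    if "1 \<le> i" "i < n" for i
  proof -
    have iv: "indep_vec H E i X 1 (\<lambda>_. X (Suc i))"
      using assms that unfolding indep_rvs_def by auto
    have "E (\<lambda>\<omega>. \<phi> (\<lambda>k. clip a b (X k \<omega>)) (\<lambda>_. clip a b (X (Suc i) \<omega>))) =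
        E (\<lambda>\<omega>. real_of_ereal (E (\<lambda>\<omega>'. \<phi> (\<lambda>k. clip a b (X k \<omega>)) (\<lambda>_. clip a b (X (Suc i) \<omega>')))))"
      if \<phi>: "\<phi> \<in> C_b_Lip i 1" for \<phi>
    proof -
      let ?\<psi> = "\<lambda>x y. \<phi> (\<lambda>k. clip a b (x k)) (\<lambda>k. clip a b (y k))"
      obtain B C where B: "\<And>x y. \<bar>\<phi> x y\<bar> \<le> B" and C: "\<And>x y x' y'. \<bar>\<phi> x y - \<phi> x' y'\<bar>
        \<le> C * sqrt ((L2_set (\<lambda>i. x i - x' i) {1..i})\<^sup>2 + (L2_set (\<lambda>j. y j - y' j) {1..1})\<^sup>2)"
        using \<phi> unfolding C_b_Lip_def by auto
      have L: "L2_set (\<lambda>i. clip a b (x i) - clip a b (x' i)) {1..k} \<le> L2_set (\<lambda>i. x i - x' i) {1..k}"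
        for x x' :: "nat \<Rightarrow> real" and k
        unfolding L2_set_def
        by (intro real_sqrt_le_mono sum_mono) (use clip_lipschitz in \<open>simp add: abs_le_square_iff\<close>)
      have "\<bar>?\<psi> x y - ?\<psi> x' y'\<bar>
        \<le> \<bar>C\<bar> * sqrt ((L2_set (\<lambda>i. x i - x' i) {1..i})\<^sup>2 + (L2_set (\<lambda>j. y j - y' j) {1..1})\<^sup>2)"
        for x y x' y'
      proof -
        have "\<bar>?\<psi> x y - ?\<psi> x' y'\<bar> \<le> C * sqrt ((L2_set (\<lambda>i. clip a b (x i) - clip a b (x' i)) {1..i})\<^sup>2
            + (L2_set (\<lambda>j. clip a b (y j) - clip a b (y' j)) {1..1})\<^sup>2)"
          by (rule C)
        also have "\<dots> \<le> \<bar>C\<bar> * sqrt ((L2_set (\<lambda>i. x i - x' i) {1..i})\<^sup>2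
            + (L2_set (\<lambda>j. y j - y' j) {1..1})\<^sup>2)"
          by (intro mult_mono real_sqrt_le_mono add_mono power_mono L L2_set_nonneg) auto
        finally show ?thesis .
      qed
      then have "?\<psi> \<in> C_b_Lip i 1" unfolding C_b_Lip_def using B by blast
      from iv[unfolded indep_vec_def, THEN conjunct2, THEN conjunct2, THEN bspec, OF this]
      show ?thesis by simp
    qed
    then show ?thesis using iv unfolding indep_vec_def by (auto intro: clip_closed)
  qed
  then show ?thesis using assms unfolding indep_rvs_def by (auto intro: clip_closed)
qed

lemma E_parameter_lipschitz:
  assumes H: "\<And>x. (\<lambda>\<omega>. \<phi> x \<omega>) \<in> H" and B: "\<And>x \<omega>. \<bar>\<phi> x \<omega>\<bar> \<le> B"
    and L: "\<And>\<omega>. \<bar>\<phi> x \<omega> - \<phi> y \<omega>\<bar> \<le> L"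
  shows "\<bar>real_of_ereal (E (\<phi> x)) - real_of_ereal (E (\<phi> y))\<bar> \<le> L"
proof -
  have fin: "ereal (real_of_ereal (E (\<phi> x))) = E (\<phi> x)" for x
    using E_finite[of "\<phi> x" B] H B by simp
  have one: "real_of_ereal (E (\<phi> x)) \<le> L + real_of_ereal (E (\<phi> y))"
    if "\<And>\<omega>. \<bar>\<phi> x \<omega> - \<phi> y \<omega>\<bar> \<le> L" for x y
  proof -
    have "E (\<phi> x) \<le> E (\<lambda>\<omega>. L + \<phi> y \<omega>)"
    proof (rule mono)
      show "\<phi> x \<omega> \<le> L + \<phi> y \<omega>" for \<omega> using that[of \<omega>] by linarith
    qed (use H in \<open>auto intro: add_closed const_closed\<close>)
    also have "\<dots> \<le> ereal L + E (\<phi> y)" by (rule E_add_const_le) (use H in simp)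
    finally have "ereal (real_of_ereal (E (\<phi> x))) \<le> ereal L + ereal (real_of_ereal (E (\<phi> y)))"
      by (simp only: fin)
    then show ?thesis by simp
  qed
  have "\<And>\<omega>. \<bar>\<phi> y \<omega> - \<phi> x \<omega>\<bar> \<le> L" using L by (simp add: abs_minus_commute)
  from one[OF L] one[OF this] show ?thesis by linarith
qed

text \<open>
  One step of conditioning.  Independence rewrites \<open>E[f (X)]\<close> as \<open>E[h (X)]\<close>, where \<open>h x\<close> is the
  expectation of \<open>f\<close> with its first \<open>k\<close> arguments frozen at \<open>x\<close>, so that \<open>g \<le> h\<close> along \<open>X\<close> suffices.
  Monotonicity of \<open>E\<close> can be used only inside \<open>H\<close>, and \<open>h (X)\<close> belongs to \<open>H\<close> because
  \<open>h\<close> inherits the Lipschitz constant of \<open>f\<close> by subadditivity.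
\<close>

lemma E_le_by_conditioning:
  assumes indep: "indep_rvs H E n X" and k: "k < n" and K: "K \<ge> 0"
    and bd: "\<And>i \<omega>. i \<in> {1..n} \<Longrightarrow> \<bar>X i \<omega>\<bar> \<le> K"
    and f: "lipschitz_on_box K (Suc k) f" and g: "lipschitz_on_box K k g"
    and le: "\<And>\<omega>. \<omega> \<in> space M \<Longrightarrow>
      ereal (g (\<lambda>i. X i \<omega>)) \<le> E (\<lambda>\<omega>'. f ((\<lambda>i. X i \<omega>)(Suc k := X (Suc k) \<omega>')))"
  shows "E (\<lambda>\<omega>. g (\<lambda>i. X i \<omega>)) \<le> E (\<lambda>\<omega>. f (\<lambda>i. X i \<omega>))"
proof (cases "k = 0")
  \<comment> \<open>Independence says nothing about the first variable; but without a past \<open>g\<close> is a constant.\<close>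
  case True
  obtain \<omega>0 where \<omega>0: "\<omega>0 \<in> space M" using space_nonempty by auto
  have "(\<lambda>\<omega>. g (\<lambda>i. X i \<omega>)) = (\<lambda>\<omega>. g (\<lambda>i. X i \<omega>0))"
    using lipschitz_on_box_cong[OF g] True by (intro ext) simp
  then have "E (\<lambda>\<omega>. g (\<lambda>i. X i \<omega>)) = ereal (g (\<lambda>i. X i \<omega>0))" by (simp only: const)
  moreover have "f ((\<lambda>i. X i \<omega>0)(Suc k := X (Suc k) \<omega>')) = f (\<lambda>i. X i \<omega>')" for \<omega>'
    using True k bd by (intro lipschitz_on_box_cong[OF f]) auto
  ultimately show ?thesis using le[OF \<omega>0] by (simp add: const)
next
  case False
  have H: "X i \<in> H" if "i \<in> {1..n}" for i using indep that unfolding indep_rvs_def by auto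
  obtain C B where C: "C \<ge> 0" and B: "\<And>x. \<bar>f (\<lambda>i. clip (-K) K (x i))\<bar> \<le> B"
    and L: "\<And>x y. \<bar>f (\<lambda>i. clip (-K) K (x i)) - f (\<lambda>i. clip (-K) K (y i))\<bar>
      \<le> C * (\<Sum>i=1..Suc k. \<bar>x i - y i\<bar>)"
    by (rule lipschitz_on_box_clip[OF f K]) (rule that, assumption+)
  define \<phi> where "\<phi> x y = f (\<lambda>i. clip (-K) K ((x(Suc k := y 1)) i))" for x y :: "nat \<Rightarrow> real"
  have \<phi>L: "\<bar>\<phi> x y - \<phi> x' y'\<bar> \<le> C * ((\<Sum>i=1..k. \<bar>x i - x' i\<bar>) + (\<Sum>j=1..1. \<bar>y j - y' j\<bar>))"
    for x y x' y'
  proof -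
    have "(\<Sum>i=1..k. \<bar>(x(Suc k := y 1)) i - (x'(Suc k := y' 1)) i\<bar>) = (\<Sum>i=1..k. \<bar>x i - x' i\<bar>)"
      by (intro sum.cong) auto
    then show ?thesis
      using L[of "x(Suc k := y 1)" "x'(Suc k := y' 1)"] unfolding \<phi>_def by simp
  qed
  have \<phi>: "\<phi> \<in> C_b_Lip k 1"
    by (rule C_b_Lip_if_lipschitz[OF C _ \<phi>L]) (use B in \<open>simp add: \<phi>_def\<close>)
  have \<phi>X: "\<phi> (\<lambda>i. X i \<omega>) (\<lambda>j. X (Suc k) \<omega>') = f ((\<lambda>i. X i \<omega>)(Suc k := X (Suc k) \<omega>'))" for \<omega> \<omega>'
    unfolding \<phi>_def
    by (rule lipschitz_on_box_cong[OF f, symmetric]) (use k bd in \<open>auto simp: clip_eq_if_abs_le\<close>)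
  have \<phi>H: "(\<lambda>\<omega>'. \<phi> x (\<lambda>j. X (Suc k) \<omega>')) \<in> H" for x
    by (rule lipschitz_closed[of 1 "\<lambda>_. X (Suc k)" C "\<phi> x"])
      (use k H C \<phi>L[of x _ x] in \<open>simp_all\<close>)
  define h where "h x = real_of_ereal (E (\<lambda>\<omega>'. \<phi> x (\<lambda>j. X (Suc k) \<omega>')))" for x
  have hfin: "ereal (h x) = E (\<lambda>\<omega>'. \<phi> x (\<lambda>j. X (Suc k) \<omega>'))" for x
    unfolding h_def by (rule E_finite[where B = B]) (use \<phi>H B in \<open>auto simp: \<phi>_def\<close>)
  have h_lipschitz: "\<bar>h x - h y\<bar> \<le> C * (\<Sum>i=1..k. \<bar>x i - y i\<bar>)" for x y
    unfolding h_def
  proof (rule E_parameter_lipschitz[of "\<lambda>x \<omega>'. \<phi> x (\<lambda>j. X (Suc k) \<omega>')", OF \<phi>H, where B = B])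
    show "\<bar>\<phi> x (\<lambda>j. X (Suc k) \<omega>)\<bar> \<le> B" for x \<omega> using B by (simp add: \<phi>_def)
    show "\<bar>\<phi> x (\<lambda>j. X (Suc k) \<omega>) - \<phi> y (\<lambda>j. X (Suc k) \<omega>)\<bar> \<le> C * (\<Sum>i=1..k. \<bar>x i - y i\<bar>)" for \<omega>
      using \<phi>L[of x "\<lambda>j. X (Suc k) \<omega>" y "\<lambda>j. X (Suc k) \<omega>"] by simp
  qed
  have hH: "(\<lambda>\<omega>. h (\<lambda>i. X i \<omega>)) \<in> H"
    by (rule lipschitz_closed[of k X C h, OF _ _ C h_lipschitz]) (use False k H in auto)
  have gH: "(\<lambda>\<omega>. g (\<lambda>i. X i \<omega>)) \<in> H"
    by (rule lipschitz_on_box_closed[OF g K]) (use k H bd in auto)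
  have "E (\<lambda>\<omega>. g (\<lambda>i. X i \<omega>)) \<le> E (\<lambda>\<omega>. h (\<lambda>i. X i \<omega>))"
  proof (rule mono[OF hH gH])
    fix \<omega> assume "\<omega> \<in> space M"
    from le[OF this] show "g (\<lambda>i. X i \<omega>) \<le> h (\<lambda>i. X i \<omega>)"
      unfolding \<phi>X[symmetric] hfin[symmetric] by simp
  qed
  also have "\<dots> = E (\<lambda>\<omega>. \<phi> (\<lambda>i. X i \<omega>) (\<lambda>j. X (Suc k) \<omega>))"
  proof -
    have "indep_vec H E k X 1 (\<lambda>_. X (Suc k))"
      using indep False k unfolding indep_rvs_def by auto
    then show ?thesis using \<phi> unfolding indep_vec_def h_def by simp
  qed
  also have "\<dots> = E (\<lambda>\<omega>. f (\<lambda>i. X i \<omega>))" unfolding \<phi>X by (simp add: fun_upd_idem)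
  finally show ?thesis .
qed

section \<open>The capacity of leaving the region of an open gate\<close>

text \<open>
  The common core of the two inequalities.  In expectation, the stopped process
  accumulates at least \<open>p k\<close>, up to the loss \<open>r k\<close>, in each step in which the gate is open, and it cannot accumulate more than \<open>U\<close>; so the
  gate must close with a certain capacity.  The bounds \<open>p\<close> and \<open>r\<close> are kept apart because the weights
  \<open>\<eta>\<^sub>k\<close> have to be estimated from below by \<open>1 - \<xi>\<close> at the former, and from above by \<open>1\<close> at the
  latter.
\<close>

lemma capacity_ge_of_gate:
  fixes f u :: "real \<Rightarrow> real" and p r :: "nat \<Rightarrow> real"
  assumes indep: "indep_rvs H E n X" and n: "n \<ge> 1" and K: "K \<ge> 0"
    and bd: "\<And>i \<omega>. i \<in> {1..n} \<Longrightarrow> \<bar>X i \<omega>\<bar> \<le> K"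
    and S: "\<And>k \<omega>. S k \<omega> = (\<Sum>i=1..k. X i \<omega>)"
    and f_lip: "C-lipschitz_on UNIV f" and f_range: "\<And>s. 0 \<le> f s \<and> f s \<le> 1" and f0: "f 0 = 1"
    and u_lip: "D-lipschitz_on {- (real n * K)..real n * K} u" and u0: "u 0 = 0"
    and p: "\<And>k. k < n \<Longrightarrow> p k \<ge> 0" and r: "\<And>k. k < n \<Longrightarrow> r k \<ge> 0" and P: "(\<Sum>k<n. p k) > 0"
    and drift: "\<And>k \<omega>. k < n \<Longrightarrow> \<omega> \<in> space M \<Longrightarrow> f (S k \<omega>) \<noteq> 0 \<Longrightarrow>
      ereal (p k - r k) \<le> E (\<lambda>\<omega>'. u (S k \<omega> + X (Suc k) \<omega>') - u (S k \<omega>))"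
    and U: "\<And>k \<omega>. k < n \<Longrightarrow> \<omega> \<in> space M \<Longrightarrow> f (S k \<omega>) \<noteq> 0 \<Longrightarrow> u (S (Suc k) \<omega>) \<le> U"
    and A: "\<And>k \<omega>. k \<in> {1..n} \<Longrightarrow> \<omega> \<in> space M \<Longrightarrow> \<omega> \<notin> A \<Longrightarrow> f (S k \<omega>) = 1"
  shows "ereal (1 - (U + (\<Sum>k<n. r k)) / (\<Sum>k<n. p k)) \<le> upper_capacity M H E A"
proof -
  have H: "X i \<in> H" if "i \<in> {1..n}" for i using indep that unfolding indep_rvs_def by auto
  define T where "T k x = (\<Sum>i=1..k. x i)" for k and x :: "nat \<Rightarrow> real"
  define \<eta> where "\<eta> k x = (\<Prod>i\<le>k. f (T i x))" for k x
  define F where "F m x = (\<Sum>k<m. \<eta> k x * (u (T (Suc k) x) - u (T k x) - (p k - r k)))" for m x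
  have TX: "T k (\<lambda>i. X i \<omega>) = S k \<omega>" for k \<omega> unfolding T_def S by simp
  have lip_u: "lipschitz_on_box K k (\<lambda>x. u (T k x))" if "k \<le> n" for k
    unfolding T_def
  proof (rule lipschitz_on_box_partial_sum[OF lipschitz_on_subset[OF u_lip]])
    have "real k * K \<le> real n * K" using that K by (intro mult_right_mono) auto
    then show "{- (real k * K)..real k * K} \<subseteq> {- (real n * K)..real n * K}" by auto
  qed
  have lip_\<eta>: "lipschitz_on_box K k (\<eta> k)" for k
    unfolding \<eta>_def T_def
    by (intro lipschitz_on_box_prod K lipschitz_on_box_weaken[OF lipschitz_on_box_partial_sum
      [OF lipschitz_on_subset[OF f_lip]]]) auto
  have lip_F: "lipschitz_on_box K m (F m)" if "m \<le> n" for m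
    unfolding F_def
  proof (intro lipschitz_on_box_sum lipschitz_on_box_mult K)
    fix k assume k: "k \<in> {..<m}"
    show "lipschitz_on_box K m (\<eta> k)" using lipschitz_on_box_weaken[OF lip_\<eta>] k by simp
    have "lipschitz_on_box K m (\<lambda>x. u (T (Suc k) x) + ((-1) * u (T k x) + (- (p k - r k))))"
      by (intro lipschitz_on_box_add lipschitz_on_box_mult lipschitz_on_box_const K
        lipschitz_on_box_weaken[OF lip_u]) (use k that in auto)
    then show "lipschitz_on_box K m (\<lambda>x. u (T (Suc k) x) - u (T k x) - (p k - r k))"
      by (simp add: algebra_simps)
  qed simp
  have step: "E (\<lambda>\<omega>. F m (\<lambda>i. X i \<omega>)) \<le> E (\<lambda>\<omega>. F (Suc m) (\<lambda>i. X i \<omega>))" if m: "m < n" for m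
  proof (rule E_le_by_conditioning[OF indep m K bd])
    fix \<omega> assume \<omega>: "\<omega> \<in> space M"
    let ?x = "\<lambda>i. X i \<omega>"
    let ?x' = "\<lambda>\<omega>'. ?x(Suc m := X (Suc m) \<omega>')"
    define Y where "Y \<omega>' = u (S m \<omega> + X (Suc m) \<omega>') - u (S m \<omega>)" for \<omega>'
    have T': "T k (?x' \<omega>') = S k \<omega>" if "k \<le> m" for k \<omega>'
      unfolding T_def S using that by (intro sum.cong) auto
    have TSuc: "T (Suc m) (?x' \<omega>') = S m \<omega> + X (Suc m) \<omega>'" for \<omega>'
      unfolding T_def S by simp
    have \<eta>': "\<eta> k (?x' \<omega>') = \<eta> k ?x" if "k \<le> m" for k \<omega>'
      unfolding \<eta>_def using that T' TX by (intro prod.cong) auto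
    \<comment> \<open>Only the last summand of \<open>F (Suc m)\<close> involves the new variable, and it is affine in \<open>Y\<close>.\<close>
    have "F m (?x' \<omega>') = F m ?x" for \<omega>'
      unfolding F_def by (intro sum.cong) (auto simp: \<eta>' T' TX)
    then have F': "F (Suc m) (?x' \<omega>') =
        (F m ?x - \<eta> m ?x * (p m - r m)) + \<eta> m ?x * Y \<omega>'" for \<omega>'
      unfolding F_def sum.lessThan_Suc Y_def TSuc T'[OF order_refl] \<eta>'[OF order_refl]
      by (simp add: algebra_simps)
    have Sle: "\<bar>S m \<omega>\<bar> \<le> real m * K" unfolding S using bd m by (intro abs_sum_le_box) auto
    have YH: "Y \<in> H"
    proof -
      have "lipschitz_on_box K 1 (\<lambda>x. u (S m \<omega> + x 1))"
        unfolding lipschitz_on_box_def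
      proof (intro exI[of _ D] conjI allI impI lipschitz_on_nonneg[OF u_lip])
        fix x y :: "nat \<Rightarrow> real" assume xy: "\<forall>i\<in>{1..1}. \<bar>x i\<bar> \<le> K \<and> \<bar>y i\<bar> \<le> K"
        have "real (Suc m) * K \<le> real n * K" using m K by (intro mult_right_mono) auto
        then have "\<bar>S m \<omega> + x 1\<bar> \<le> real n * K" "\<bar>S m \<omega> + y 1\<bar> \<le> real n * K"
          using Sle xy by (auto simp: algebra_simps)
        then show "\<bar>u (S m \<omega> + x 1) - u (S m \<omega> + y 1)\<bar> \<le> D * (\<Sum>i=1..1. \<bar>x i - y i\<bar>)"
          using lipschitz_onD[OF u_lip, of "S m \<omega> + x 1" "S m \<omega> + y 1"]
          by (auto simp: dist_real_def abs_le_iff)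
      qed
      from lipschitz_on_box_closed[OF this K, of "\<lambda>_. X (Suc m)"]
      have "(\<lambda>\<omega>'. u (S m \<omega> + X (Suc m) \<omega>')) \<in> H" using H bd m by simp
      from add_closed[OF this const_closed[of "- u (S m \<omega>)"]] show ?thesis
        unfolding Y_def by simp
    qed
    have \<eta>0: "\<eta> m ?x \<ge> 0" unfolding \<eta>_def using f_range by (intro prod_nonneg) auto
    show "ereal (F m ?x) \<le> E (\<lambda>\<omega>'. F (Suc m) (?x' \<omega>'))"
    proof (cases "\<eta> m ?x = 0")
      case True
      then show ?thesis unfolding F' by (simp add: const)
    next
      case False
      then have "f (S m \<omega>) \<noteq> 0" unfolding \<eta>_def TX by simp
      from drift[OF m \<omega> this] have "ereal (p m - r m) \<le> E Y" unfolding Y_def .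
      from E_affine_ge[OF YH \<eta>0 this, of "F m ?x - \<eta> m ?x * (p m - r m)"]
      show ?thesis unfolding F' by simp
    qed
  qed (use lip_F m in auto)
  have "0 \<le> E (\<lambda>\<omega>. F m (\<lambda>i. X i \<omega>))" if "m \<le> n" for m
    using that
  proof (induction m)
    case 0
    then show ?case by (simp add: F_def const zero_ereal_def)
  next
    case (Suc m)
    then show ?case using order_trans[OF _ step[of m]] by simp
  qed
  then have EF: "0 \<le> E (\<lambda>\<omega>. F n (\<lambda>i. X i \<omega>))" by simp
  have FH: "(\<lambda>\<omega>. F n (\<lambda>i. X i \<omega>)) \<in> H"
    by (intro lipschitz_on_box_closed[OF lip_F K] H bd) auto
  define Ps where "Ps = (\<Sum>k<n. p k)"
  define R where "R = (\<Sum>k<n. r k)"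
  \<comment> \<open>The upper bound for \<open>F n\<close> is affine in \<open>\<xi>\<close>, so \<open>0 \<le> E[F n]\<close> becomes a lower bound for \<open>E \<xi>\<close>.\<close>
  have "ereal (1 - (U + R) / Ps) \<le> E \<xi>"
    if \<xi>: "\<xi> \<in> H" "\<forall>\<omega>\<in>space M. indicator A \<omega> \<le> \<xi> \<omega>" for \<xi>
  proof -
    have "F n (\<lambda>i. X i \<omega>) \<le> (U + R - Ps) + Ps * \<xi> \<omega>" if \<omega>: "\<omega> \<in> space M" for \<omega>
    proof -
      let ?e = "\<lambda>k. \<eta> k (\<lambda>i. X i \<omega>)"
      have e0: "?e 0 = 1" unfolding \<eta>_def TX by (simp add: S f0)
      have epos: "?e k \<ge> 0" for k unfolding \<eta>_def using f_range by (intro prod_nonneg) auto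
      have edec: "?e (Suc k) \<le> ?e k" for k
      proof -
        have "?e (Suc k) = ?e k * f (S (Suc k) \<omega>)" unfolding \<eta>_def TX by simp
        then show ?thesis using mult_left_le[of "f (S (Suc k) \<omega>)" "?e k"] f_range epos by simp
      qed
      have anti: "?e n \<le> ?e k" if "k \<le> n" for k
        using lift_Suc_antimono_le[of ?e, OF edec that] .
      have e1: "?e k \<le> 1" for k using lift_Suc_antimono_le[of ?e 0 k, OF edec] e0 by simp
      have inc: "(\<Sum>k<n. ?e k * (u (S (Suc k) \<omega>) - u (S k \<omega>))) \<le> U"
      proof (rule stopped_increments_le[OF e0 _ n epos edec])
        show "u (S 0 \<omega>) = 0" by (simp add: S u0)
        fix k assume "k < n" "?e k \<noteq> 0"
        then show "u (S (Suc k) \<omega>) \<le> U" using U[OF _ \<omega>, of k] unfolding \<eta>_def TX by simp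
      qed
      have xi: "1 - \<xi> \<omega> \<le> ?e n"
      proof (cases "\<omega> \<in> A")
        case True
        then have "\<xi> \<omega> \<ge> 1" using \<xi>(2) \<omega> by force
        then show ?thesis using epos[of n] by linarith
      next
        case False
        have "f (S k \<omega>) = 1" if "k \<le> n" for k
          using A[OF _ \<omega> False, of k] that by (cases "k = 0") (auto simp: S f0)
        then have "?e n = 1" unfolding \<eta>_def TX by simp
        moreover have "\<xi> \<omega> \<ge> 0" using \<xi>(2) \<omega> False by force
        ultimately show ?thesis by simp
      qed
      have "Ps * (1 - \<xi> \<omega>) \<le> Ps * ?e n" using xi P unfolding Ps_def by (intro mult_left_mono) auto
      also have "\<dots> \<le> (\<Sum>k<n. ?e k * p k)"
        unfolding Ps_def sum_distrib_right
        by (intro sum_mono) (use p anti in \<open>auto simp: mult.commute intro!: mult_left_mono\<close>)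
      finally have 1: "Ps * (1 - \<xi> \<omega>) \<le> (\<Sum>k<n. ?e k * p k)" .
      have 2: "(\<Sum>k<n. ?e k * r k) \<le> R"
        unfolding R_def
        by (intro sum_mono) (use r e1 epos in \<open>auto intro!: mult_left_le_one_le\<close>)
      have "F n (\<lambda>i. X i \<omega>) = (\<Sum>k<n. ?e k * (u (S (Suc k) \<omega>) - u (S k \<omega>)))
          - (\<Sum>k<n. ?e k * p k) + (\<Sum>k<n. ?e k * r k)"
        unfolding F_def TX sum_subtractf[symmetric] sum.distrib[symmetric]
        by (intro sum.cong) (auto simp: algebra_simps)
      then show ?thesis using inc 1 2 by (simp add: algebra_simps)
    qed
    then have "E (\<lambda>\<omega>. F n (\<lambda>i. X i \<omega>)) \<le> E (\<lambda>\<omega>. (U + R - Ps) + Ps * \<xi> \<omega>)"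
      by (intro mono FH add_closed const_closed scale_closed \<xi>) auto
    also have "\<dots> \<le> ereal (U + R - Ps) + E (\<lambda>\<omega>. Ps * \<xi> \<omega>)"
      by (intro E_add_const_le scale_closed \<xi>)
    also have "E (\<lambda>\<omega>. Ps * \<xi> \<omega>) = ereal Ps * E \<xi>"
      using P \<xi> unfolding Ps_def by (intro pos_homogeneous) auto
    finally have main: "0 \<le> ereal (U + R - Ps) + ereal Ps * E \<xi>" using EF by simp
    have "0 \<le> \<xi> \<omega>" if "\<omega> \<in> space M" for \<omega>
      using \<xi>(2) that by (metis indicator_pos_le order_trans)
    then have "ereal 0 \<le> E \<xi>" by (intro E_ge_const \<xi>)
    then show ?thesis using main P unfolding Ps_def[symmetric]
      by (cases "E \<xi>") (auto simp: field_simps)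
  qed
  then show ?thesis
    unfolding upper_capacity_def Ps_def[symmetric] R_def[symmetric] by (intro Inf_greatest) auto
qed

lemma E_scale_le:
  assumes "Y \<in> H" and a: "E Y = ereal a" and b: "E (\<lambda>\<omega>. - Y \<omega>) = ereal b"
  shows "E (\<lambda>\<omega>. t * Y \<omega>) \<le> ereal (\<bar>t\<bar> * (max a 0 + max b 0))"
proof (cases "t \<ge> 0")
  case True
  then have "E (\<lambda>\<omega>. t * Y \<omega>) = ereal (t * a)" using pos_homogeneous[OF assms(1)] a by simp
  moreover have "t * a \<le> \<bar>t\<bar> * (max a 0 + max b 0)"
    using True by (auto intro!: mult_left_mono)
  ultimately show ?thesis by simp
next
  case False
  then have "E (\<lambda>\<omega>. t * Y \<omega>) = ereal (- t * b)"
    using pos_homogeneous[OF uminus_closed[OF assms(1)], of "- t"] b by simp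
  moreover have "- t * b \<le> \<bar>t\<bar> * (max a 0 + max b 0)"
    using False by (auto intro!: mult_left_mono simp del: mult_minus_left)
  ultimately show ?thesis by simp
qed

end

section \<open>Gates\<close>

definition gate :: "real \<Rightarrow> real \<Rightarrow> real \<Rightarrow> real" where
  "gate a b s = clip 0 1 ((b - s) / (b - a))"

lemma gate_range: "0 \<le> gate a b s \<and> gate a b s \<le> 1"
  unfolding gate_def clip_def by simp

lemma gate_eq_1: "a < b \<Longrightarrow> s \<le> a \<Longrightarrow> gate a b s = 1"
  unfolding gate_def clip_def by (simp add: min_def le_divide_eq)

lemma gate_eq_0: "a < b \<Longrightarrow> b \<le> s \<Longrightarrow> gate a b s = 0"
  using divide_nonpos_pos[of "b - s" "b - a"] unfolding gate_def clip_def by simp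

lemma gate_lipschitz:
  assumes "a < b"
  shows "(1 / (b - a))-lipschitz_on UNIV (gate a b)"
proof (rule lipschitz_onI)
  fix s t :: real
  have "\<bar>gate a b s - gate a b t\<bar> \<le> \<bar>(b - s) / (b - a) - (b - t) / (b - a)\<bar>"
    unfolding gate_def by (rule clip_lipschitz)
  also have "(b - s) / (b - a) - (b - t) / (b - a) = (t - s) / (b - a)"
    by (simp add: diff_divide_distrib[symmetric])
  also have "\<bar>(t - s) / (b - a)\<bar> = 1 / (b - a) * dist s t"
    using assms by (simp add: dist_real_def abs_minus_commute)
  finally show "dist (gate a b s) (gate a b t) \<le> 1 / (b - a) * dist s t"
    by (simp add: dist_real_def)
qed (use assms in simp)

lemma gate_abs_lipschitz:
  assumes "a < b"
  shows "(1 / (b - a))-lipschitz_on UNIV (\<lambda>s. gate a b \<bar>s\<bar>)"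
proof (rule lipschitz_onI)
  fix s t :: real
  have "dist (gate a b \<bar>s\<bar>) (gate a b \<bar>t\<bar>) \<le> 1 / (b - a) * dist \<bar>s\<bar> \<bar>t\<bar>"
    by (rule lipschitz_onD[OF gate_lipschitz[OF assms]]) auto
  also have "\<dots> \<le> 1 / (b - a) * dist s t"
    using assms by (intro mult_left_mono) (auto simp: dist_real_def)
  finally show "dist (gate a b \<bar>s\<bar>) (gate a b \<bar>t\<bar>) \<le> 1 / (b - a) * dist s t" .
qed (use assms in simp)

lemma square_lipschitz_on:
  fixes L :: real
  assumes "L \<ge> 0"
  shows "(2 * L)-lipschitz_on {-L..L} (\<lambda>s. s\<^sup>2)"
proof (rule lipschitz_onI)
  fix s t :: real assume st: "s \<in> {-L..L}" "t \<in> {-L..L}"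
  have "dist (s\<^sup>2) (t\<^sup>2) = \<bar>s + t\<bar> * \<bar>s - t\<bar>"
    unfolding dist_real_def abs_mult[symmetric] by (simp add: power2_eq_square algebra_simps)
  also have "\<dots> \<le> (2 * L) * \<bar>s - t\<bar>" using st by (intro mult_right_mono) auto
  finally show "dist (s\<^sup>2) (t\<^sup>2) \<le> 2 * L * dist s t" by (simp add: dist_real_def)
qed (use assms in simp)

text \<open>
  Used to let the level at which the gate is completely closed decrease to the level of the event.
\<close>

lemma ereal_le_if_le_right:
  fixes h :: "real \<Rightarrow> real"
  assumes "isCont h x" and "\<And>y. y > x \<Longrightarrow> ereal (h y) \<le> V"
  shows "ereal (h x) \<le> V"
proof (rule tendsto_upperbound)
  have "(h \<longlongrightarrow> h x) (at_right x)"
    by (rule tendsto_mono[OF at_le[OF subset_UNIV] isContD[OF assms(1)]])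
  then show "((\<lambda>y. ereal (h y)) \<longlongrightarrow> ereal (h x)) (at_right x)" by simp
  show "\<forall>\<^sub>F y in at_right x. ereal (h y) \<le> V"
    using assms(2) by (auto simp: eventually_at_filter)
qed simp

section \<open>The one-sided and the two-sided bound\<close>

context sublinear_expectation_space
begin

text \<open>
  The core inequality is applied to the variables truncated to \<open>[- n c, c]\<close>, with \<open>u\<close> the identity.
  Truncation from below can only increase \<open>E\<close>, so the drift is still at least \<open>e k\<close>.
\<close>

lemma capacity_ge_one_sided:
  fixes e :: "nat \<Rightarrow> real"
  assumes indep: "indep_rvs H E n X"
    and S: "\<And>k \<omega>. S k \<omega> = (\<Sum>i=1..k. X i \<omega>)"
    and c: "\<And>k \<omega>. k \<in> {1..n} \<Longrightarrow> \<omega> \<in> space M \<Longrightarrow> X k \<omega> \<le> c"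
    and e: "\<And>k. k \<in> {1..n} \<Longrightarrow> E (X k) = ereal (e k)"
    and e0: "\<And>k. k \<in> {1..n} \<Longrightarrow> e k \<ge> 0" and pos: "(\<Sum>k=1..n. e k) > 0"
    and x: "x > 0" "x < y"
  shows "ereal (1 - (y + c) / (\<Sum>k=1..n. e k))
    \<le> upper_capacity M H E {\<omega> \<in> space M. Max ((\<lambda>k. S k \<omega>) ` {1..n}) > x}"
proof -
  have H: "X i \<in> H" if "i \<in> {1..n}" for i using indep that unfolding indep_rvs_def by auto
  have n: "n \<ge> 1" using pos by (cases n) auto
  have "e 1 \<le> c" using E_le_const[OF H c, of 1] e[of 1] n by simp
  then have c0: "c \<ge> 0" using e0[of 1] n by simp
  define X' where "X' k \<omega> = clip (- (real n * c)) c (X k \<omega>)" for k \<omega>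
  define S' where "S' k \<omega> = (\<Sum>i=1..k. X' i \<omega>)" for k \<omega>
  have X'c: "X' k \<omega> \<le> c" for k \<omega>
    unfolding X'_def clip_def using c0 by (simp add: order_trans[of _ 0])
  have X'b: "- (real n * c) \<le> X' k \<omega>" for k \<omega> unfolding X'_def clip_def by simp
  have XX': "E (X k) \<le> E (X' k)" if "k \<in> {1..n}" for k
  proof (rule mono[OF _ H[OF that]])
    show "X' k \<in> H" using clip_closed[OF H[OF that]] unfolding X'_def .
    show "X k \<omega> \<le> X' k \<omega>" if "\<omega> \<in> space M" for \<omega>
      using c[OF \<open>k \<in> {1..n}\<close> that] unfolding X'_def clip_def by simp
  qed
  \<comment> \<open>If the truncated walk is above \<open>x > 0\<close> at time \<open>k\<close>, no step up to then was truncated: one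
    step \<open>- n c\<close> and fewer than \<open>n\<close> steps of size at most \<open>c\<close> have a sum that is at most \<open>0\<close>.\<close>
  have event: "S' k \<omega> \<le> x" if \<omega>: "\<omega> \<in> space M" and k: "k \<in> {1..n}"
    and A: "\<not> Max ((\<lambda>k. S k \<omega>) ` {1..n}) > x" for k \<omega>
  proof (rule ccontr)
    assume *: "\<not> S' k \<omega> \<le> x"
    have "X' i \<omega> = X i \<omega>" if i: "i \<in> {1..k}" for i
    proof (rule ccontr)
      assume ne: "X' i \<omega> \<noteq> X i \<omega>"
      have "X i \<omega> \<le> c" using c[OF _ \<omega>, of i] i k by simp
      then have "X' i \<omega> = - (real n * c)" using ne unfolding X'_def clip_def by linarith
      moreover have "S' k \<omega> = X' i \<omega> + (\<Sum>j\<in>{1..k} - {i}. X' j \<omega>)"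
        unfolding S'_def using i by (intro sum.remove) auto
      moreover have "(\<Sum>j\<in>{1..k} - {i}. X' j \<omega>) \<le> real (card ({1..k} - {i})) * c"
        by (rule sum_bounded_above) (rule X'c)
      moreover have "real (card ({1..k} - {i})) * c \<le> real n * c"
        using i k c0 by (intro mult_right_mono) auto
      ultimately show False using * x by linarith
    qed
    then have "S' k \<omega> = S k \<omega>" unfolding S'_def S by (intro sum.cong) auto
    moreover have "S k \<omega> \<le> Max ((\<lambda>k. S k \<omega>) ` {1..n})" using k by (intro Max_ge) auto
    ultimately show False using * A by simp
  qed
  have shift: "(\<Sum>k=1..n. e k) = (\<Sum>k<n. e (Suc k))" by (simp add: sum.atLeast1_atMost_eq)
  have "ereal (1 - (y + c + (\<Sum>k<n. 0)) / (\<Sum>k<n. e (Suc k)))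
    \<le> upper_capacity M H E {\<omega> \<in> space M. Max ((\<lambda>k. S k \<omega>) ` {1..n}) > x}"
  proof (rule capacity_ge_of_gate[where X = X' and S = S' and f = "gate x y" and u = "\<lambda>s. s"
        and K = "real n * c + c", OF _ n _ _ S'_def gate_lipschitz[OF x(2)] gate_range])
    show "indep_rvs H E n X'" using indep_rvs_clip[OF indep] unfolding X'_def .
    show "\<bar>X' i \<omega>\<bar> \<le> real n * c + c" for i \<omega>
    proof -
      have "0 \<le> real n * c" using c0 by simp
      then show ?thesis using X'c[of i \<omega>] X'b[of i \<omega>] c0 by linarith
    qed
    show "1-lipschitz_on {- (real n * (real n * c + c))..real n * (real n * c + c)} (\<lambda>s::real. s)"
      by (rule lipschitz_onI) auto
    show "ereal (e (Suc k) - 0) \<le> E (\<lambda>\<omega>'. S' k \<omega> + X' (Suc k) \<omega>' - S' k \<omega>)" if "k < n" for k \<omega>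
      using XX'[of "Suc k"] e[of "Suc k"] that by simp
    show "S' (Suc k) \<omega> \<le> y + c" if "gate x y (S' k \<omega>) \<noteq> 0" for k \<omega>
    proof -
      have "S' k \<omega> < y" using that gate_eq_0[OF x(2), of "S' k \<omega>"] by force
      then show ?thesis using X'c[of "Suc k" \<omega>] unfolding S'_def by simp
    qed
    show "gate x y (S' k \<omega>) = 1" if "k \<in> {1..n}" "\<omega> \<in> space M"
      "\<omega> \<notin> {\<omega> \<in> space M. x < Max ((\<lambda>k. S k \<omega>) ` {1..n})}" for k \<omega>
      using event[OF that(2,1)] that(2,3) by (intro gate_eq_1 x) auto
  qed (use c0 e0 pos shift x in \<open>auto intro: gate_eq_1\<close>)
  then show ?thesis unfolding shift by simp
qed

text \<open>
  The core inequality with \<open>u s = s\<^sup>2\<close>, where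
  \<open>u (s + X\<^sub>k) - u s = X\<^sub>k\<^sup>2 + 2 s X\<^sub>k\<close>.  The cross term does not vanish, because \<open>E (X k)\<close> and
  \<open>E (- X k)\<close> may be different from zero; for \<open>\<bar>s\<bar> \<le> y\<close> it costs at most \<open>2 y\<close> times the sum of
  their positive parts.
\<close>

lemma capacity_ge_two_sided:
  fixes a b q :: "nat \<Rightarrow> real"
  assumes indep: "indep_rvs H E n X"
    and S: "\<And>k \<omega>. S k \<omega> = (\<Sum>i=1..k. X i \<omega>)"
    and c: "\<And>k \<omega>. k \<in> {1..n} \<Longrightarrow> \<omega> \<in> space M \<Longrightarrow> \<bar>X k \<omega>\<bar> \<le> c"
    and a: "\<And>k. k \<in> {1..n} \<Longrightarrow> E (X k) = ereal (a k)"
    and b: "\<And>k. k \<in> {1..n} \<Longrightarrow> E (\<lambda>\<omega>. - X k \<omega>) = ereal (b k)"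
    and q: "\<And>k. k \<in> {1..n} \<Longrightarrow> E (\<lambda>\<omega>. (X k \<omega>)\<^sup>2) = ereal (q k)"
    and pos: "(\<Sum>k=1..n. q k) > 0"
    and x: "x > 0" "x < y"
  shows "ereal (1 - ((y + c)\<^sup>2 + 2 * y * (\<Sum>k=1..n. max (a k) 0 + max (b k) 0)) / (\<Sum>k=1..n. q k))
    \<le> upper_capacity M H E {\<omega> \<in> space M. Max ((\<lambda>k. \<bar>S k \<omega>\<bar>) ` {1..n}) > x}"
proof -
  have H: "X i \<in> H" if "i \<in> {1..n}" for i using indep that unfolding indep_rvs_def by auto
  have n: "n \<ge> 1" using pos by (cases n) auto
  obtain \<omega>0 where "\<omega>0 \<in> space M" using space_nonempty by auto
  from c[OF _ this, of 1] n have c0: "c \<ge> 0" by simp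
  define X' where "X' k \<omega> = clip (- c) c (X k \<omega>)" for k \<omega>
  define S' where "S' k \<omega> = (\<Sum>i=1..k. X' i \<omega>)" for k \<omega>
  have bd: "\<bar>X' k \<omega>\<bar> \<le> c" for k \<omega> unfolding X'_def by (rule abs_clip_le[OF c0])
  have XX': "X' k \<omega> = X k \<omega>" if "k \<in> {1..n}" "\<omega> \<in> space M" for k \<omega>
    unfolding X'_def by (rule clip_eq_if_abs_le[OF c[OF that]])
  have H': "X' k \<in> H" if "k \<in> {1..n}" for k
    using clip_closed[OF H[OF that]] unfolding X'_def .
  have a': "E (X' k) = ereal (a k)" if "k \<in> {1..n}" for k
    using E_cong[OF H' H] XX' a that by simp
  have b': "E (\<lambda>\<omega>. - X' k \<omega>) = ereal (b k)" if "k \<in> {1..n}" for k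
    using E_cong[OF uminus_closed[OF H'] uminus_closed[OF H]] XX' b that by simp
  have q': "E (\<lambda>\<omega>. (X' k \<omega>)\<^sup>2) = ereal (q k)" if "k \<in> {1..n}" for k
    using E_cong[OF square_closed[OF H'] square_closed[OF H]] XX' q that by simp
  have q0: "q k \<ge> 0" if "k \<in> {1..n}" for k
    using E_ge_const[OF square_closed[OF H[OF that]], of 0] q[OF that] by simp
  define d where "d k = max (a k) 0 + max (b k) 0" for k
  have d0: "d k \<ge> 0" for k unfolding d_def by simp
  have drift: "ereal (q (Suc k) - 2 * y * d (Suc k)) \<le> E (\<lambda>\<omega>'. (s + X' (Suc k) \<omega>')\<^sup>2 - s\<^sup>2)"
    if k: "k < n" and s: "\<bar>s\<bar> \<le> y" for k s
  proof -
    let ?Y = "X' (Suc k)"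
    have Y: "?Y \<in> H" using H' k by simp
    let ?Z = "\<lambda>\<omega>'. (s + ?Y \<omega>')\<^sup>2 - s\<^sup>2"
    have "?Z = (\<lambda>\<omega>'. (?Y \<omega>')\<^sup>2 + 2 * s * ?Y \<omega>')"
      by (rule ext) (simp add: power2_eq_square algebra_simps)
    then have ZH: "?Z \<in> H" using add_closed[OF square_closed[OF Y] scale_closed[OF Y, of "2 * s"]] by simp
    have WH: "(\<lambda>\<omega>'. (- 2 * s) * ?Y \<omega>') \<in> H" by (rule scale_closed[OF Y])
    have W: "E (\<lambda>\<omega>'. (- 2 * s) * ?Y \<omega>') \<le> ereal (2 * y * d (Suc k))"
    proof -
      have "E (\<lambda>\<omega>'. (- 2 * s) * ?Y \<omega>') \<le> ereal (\<bar>- 2 * s\<bar> * d (Suc k))"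
        unfolding d_def using k by (intro E_scale_le Y a' b') auto
      also have "\<dots> \<le> ereal (2 * y * d (Suc k))"
        using mult_right_mono[of "\<bar>s\<bar>" y "d (Suc k)"] s d0 by (simp add: abs_mult)
      finally show ?thesis .
    qed
    have Wfin: "E (\<lambda>\<omega>'. (- 2 * s) * ?Y \<omega>') \<noteq> - \<infinity>"
    proof
      assume inf: "E (\<lambda>\<omega>'. (- 2 * s) * ?Y \<omega>') = - \<infinity>"
      have "ereal (- (2 * \<bar>s\<bar> * c)) \<le> E (\<lambda>\<omega>'. (- 2 * s) * ?Y \<omega>')"
      proof (rule E_ge_const[OF WH])
        fix \<omega>'
        have "\<bar>(- 2 * s) * ?Y \<omega>'\<bar> \<le> 2 * \<bar>s\<bar> * c"
          using mult_left_mono[OF bd[of "Suc k" \<omega>'], of "2 * \<bar>s\<bar>"] by (simp add: abs_mult)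
        then show "- (2 * \<bar>s\<bar> * c) \<le> (- 2 * s) * ?Y \<omega>'" by linarith
      qed
      then show False using inf by simp
    qed
    \<comment> \<open>Subadditivity for \<open>X\<^sup>2\<close> as the sum of the increment and minus the cross term gives the lower
      bound.\<close>
    have "ereal (q (Suc k)) = E (\<lambda>\<omega>'. ?Z \<omega>' + (- 2 * s) * ?Y \<omega>')"
      using q'[of "Suc k"] k by (simp add: power2_eq_square algebra_simps)
    also have "\<dots> \<le> E ?Z + E (\<lambda>\<omega>'. (- 2 * s) * ?Y \<omega>')"
      by (rule subadd[OF ZH WH]) (use W Wfin in auto)
    also have "\<dots> \<le> E ?Z + ereal (2 * y * d (Suc k))" by (rule add_left_mono[OF W])
    finally show ?thesis by (cases "E ?Z") auto
  qed
  have shift: "(\<Sum>k=1..n. h k) = (\<Sum>k<n. h (Suc k))" for h :: "nat \<Rightarrow> real"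
    by (simp add: sum.atLeast1_atMost_eq)
  have lt: "\<bar>s\<bar> < y" if "gate x y \<bar>s\<bar> \<noteq> 0" for s
    using that gate_eq_0[OF x(2), of "\<bar>s\<bar>"] by force
  have "ereal (1 - ((y + c)\<^sup>2 + (\<Sum>k<n. 2 * y * d (Suc k))) / (\<Sum>k<n. q (Suc k)))
    \<le> upper_capacity M H E {\<omega> \<in> space M. Max ((\<lambda>k. \<bar>S k \<omega>\<bar>) ` {1..n}) > x}"
  proof (rule capacity_ge_of_gate[where X = X' and S = S' and f = "\<lambda>s. gate x y \<bar>s\<bar>"
        and u = "\<lambda>s. s\<^sup>2" and K = c, OF _ n c0 bd S'_def gate_abs_lipschitz[OF x(2)] gate_range])
    show "indep_rvs H E n X'" using indep_rvs_clip[OF indep] unfolding X'_def .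
    show "(2 * (real n * c))-lipschitz_on {- (real n * c)..real n * c} (\<lambda>s. s\<^sup>2)"
      using c0 by (intro square_lipschitz_on) simp
    show "ereal (q (Suc k) - 2 * y * d (Suc k)) \<le> E (\<lambda>\<omega>'. (S' k \<omega> + X' (Suc k) \<omega>')\<^sup>2 - (S' k \<omega>)\<^sup>2)"
      if "k < n" "gate x y \<bar>S' k \<omega>\<bar> \<noteq> 0" for k \<omega>
      using drift[OF that(1)] lt[OF that(2)] by simp
    show "(S' (Suc k) \<omega>)\<^sup>2 \<le> (y + c)\<^sup>2" if "gate x y \<bar>S' k \<omega>\<bar> \<noteq> 0" for k \<omega>
    proof -
      have "S' (Suc k) \<omega> = S' k \<omega> + X' (Suc k) \<omega>" unfolding S'_def by simp
      then have "\<bar>S' (Suc k) \<omega>\<bar> \<le> y + c" using bd[of "Suc k" \<omega>] lt[OF that] by linarith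
      then show ?thesis using power_mono[of "\<bar>S' (Suc k) \<omega>\<bar>" "y + c" 2] by simp
    qed
    show "gate x y \<bar>S' k \<omega>\<bar> = 1" if k: "k \<in> {1..n}" and \<omega>: "\<omega> \<in> space M"
      and A: "\<omega> \<notin> {\<omega> \<in> space M. x < Max ((\<lambda>k. \<bar>S k \<omega>\<bar>) ` {1..n})}" for k \<omega>
    proof (rule gate_eq_1[OF x(2)])
      have "S' k \<omega> = S k \<omega>" unfolding S'_def S using k XX' \<omega> by (intro sum.cong) auto
      moreover have "\<bar>S k \<omega>\<bar> \<le> Max ((\<lambda>k. \<bar>S k \<omega>\<bar>) ` {1..n})" using k by (intro Max_ge) auto
      ultimately show "\<bar>S' k \<omega>\<bar> \<le> x" using A \<omega> by simp
    qed
  qed (use q0 d0 pos shift x in \<open>auto intro: gate_eq_1\<close>)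
  then show ?thesis unfolding d_def[symmetric] shift by (simp add: sum_distrib_left)
qed

end

section \<open>The maximal inequalities\<close>

theorem lemma2p2:
  fixes M :: "'a measure" and H :: "('a \<Rightarrow> real) set" and E :: "('a \<Rightarrow> real) \<Rightarrow> ereal"
    and X S :: "nat \<Rightarrow> 'a \<Rightarrow> real" and n :: nat and c :: real
  assumes space: "sublinear_expectation_space M H E"
    and indep: "indep_rvs H E n X"
    and S_def: "\<And>k \<omega>. S k \<omega> = (\<Sum>i=1..k. X i \<omega>)"
  shows
    "((\<forall>k\<in>{1..n}. \<forall>\<omega>\<in>space M. \<bar>X k \<omega>\<bar> \<le> c) \<and> (\<Sum>k=1..n. E (\<lambda>\<omega>. (X k \<omega>)\<^sup>2)) > 0 \<longrightarrow>
       (\<forall>x::real. x > 0 \<longrightarrow>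
         upper_capacity M H E {\<omega> \<in> space M. Max ((\<lambda>k. \<bar>S k \<omega>\<bar>) ` {1..n}) > x}
           \<ge> 1 - (ereal ((x + c)\<^sup>2)
                   + ereal (2 * x) * (\<Sum>k=1..n. max (E (X k)) 0 + max (E (\<lambda>\<omega>. - X k \<omega>)) 0))
                 / (\<Sum>k=1..n. E (\<lambda>\<omega>. (X k \<omega>)\<^sup>2))))
     \<and>
     ((\<forall>k\<in>{1..n}. \<forall>\<omega>\<in>space M. X k \<omega> \<le> c) \<and> (\<forall>k\<in>{1..n}. E (X k) \<ge> 0)
        \<and> (\<Sum>k=1..n. E (X k)) > 0 \<longrightarrow>
       (\<forall>x::real. x > 0 \<longrightarrow>
         upper_capacity M H E {\<omega> \<in> space M. Max ((\<lambda>k. S k \<omega>) ` {1..n}) > x}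
           \<ge> 1 - ereal (x + c) / (\<Sum>k=1..n. E (X k))))"
proof (intro conjI impI allI)
  interpret sublinear_expectation_space M H E by (rule space)
  have H: "X i \<in> H" if "i \<in> {1..n}" for i using indep that unfolding indep_rvs_def by auto
  {
    fix x :: real assume x: "x > 0"
    assume "(\<forall>k\<in>{1..n}. \<forall>\<omega>\<in>space M. \<bar>X k \<omega>\<bar> \<le> c) \<and> (\<Sum>k=1..n. E (\<lambda>\<omega>. (X k \<omega>)\<^sup>2)) > 0"
    then have c: "\<And>k \<omega>. k \<in> {1..n} \<Longrightarrow> \<omega> \<in> space M \<Longrightarrow> \<bar>X k \<omega>\<bar> \<le> c"
      and pos: "(\<Sum>k=1..n. E (\<lambda>\<omega>. (X k \<omega>)\<^sup>2)) > 0" by auto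
    define a where "a k = real_of_ereal (E (X k))" for k
    define b where "b k = real_of_ereal (E (\<lambda>\<omega>. - X k \<omega>))" for k
    define q where "q k = real_of_ereal (E (\<lambda>\<omega>. (X k \<omega>)\<^sup>2))" for k
    have a: "E (X k) = ereal (a k)" if "k \<in> {1..n}" for k
      unfolding a_def by (rule E_finite[symmetric, OF H[OF that] c[OF that]])
    have b: "E (\<lambda>\<omega>. - X k \<omega>) = ereal (b k)" if "k \<in> {1..n}" for k
      unfolding b_def using c[OF that]
      by (intro E_finite[symmetric, OF uminus_closed[OF H[OF that]], of c]) simp
    have q: "E (\<lambda>\<omega>. (X k \<omega>)\<^sup>2) = ereal (q k)" if "k \<in> {1..n}" for k
      unfolding q_def
    proof (rule E_finite[symmetric, OF square_closed[OF H[OF that]], of "c\<^sup>2"])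
      show "\<bar>(X k \<omega>)\<^sup>2\<bar> \<le> c\<^sup>2" if "\<omega> \<in> space M" for \<omega>
        using power_mono[OF c[OF \<open>k \<in> {1..n}\<close> that], of 2] by simp
    qed
    have sq: "(\<Sum>k=1..n. E (\<lambda>\<omega>. (X k \<omega>)\<^sup>2)) = ereal (\<Sum>k=1..n. q k)"
      unfolding sum_ereal[symmetric] by (intro sum.cong q) auto
    have sd: "(\<Sum>k=1..n. max (E (X k)) 0 + max (E (\<lambda>\<omega>. - X k \<omega>)) 0)
        = ereal (\<Sum>k=1..n. max (a k) 0 + max (b k) 0)"
      unfolding sum_ereal[symmetric] by (intro sum.cong) (auto simp: a b max_def)
    have q_pos: "(\<Sum>k=1..n. q k) > 0" using pos unfolding sq by simp
    let ?h = "\<lambda>x. 1 - ((x + c)\<^sup>2 + 2 * x * (\<Sum>k=1..n. max (a k) 0 + max (b k) 0))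
          / (\<Sum>k=1..n. q k)"
    have "ereal (1 - ((x + c)\<^sup>2 + 2 * x * (\<Sum>k=1..n. max (a k) 0 + max (b k) 0)) / (\<Sum>k=1..n. q k))
      \<le> upper_capacity M H E {\<omega> \<in> space M. Max ((\<lambda>k. \<bar>S k \<omega>\<bar>) ` {1..n}) > x}"
    proof (rule ereal_le_if_le_right[where h = "?h"])
      show "isCont ?h x"
        using q_pos by (intro continuous_intros) auto
    qed (rule capacity_ge_two_sided[OF indep S_def c a b q q_pos x])
    then show "upper_capacity M H E {\<omega> \<in> space M. Max ((\<lambda>k. \<bar>S k \<omega>\<bar>) ` {1..n}) > x}
           \<ge> 1 - (ereal ((x + c)\<^sup>2)
                   + ereal (2 * x) * (\<Sum>k=1..n. max (E (X k)) 0 + max (E (\<lambda>\<omega>. - X k \<omega>)) 0))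
                 / (\<Sum>k=1..n. E (\<lambda>\<omega>. (X k \<omega>)\<^sup>2))"
      unfolding sq sd using q_pos by (simp add: one_ereal_def)
  }
  {
    fix x :: real assume x: "x > 0"
    assume "(\<forall>k\<in>{1..n}. \<forall>\<omega>\<in>space M. X k \<omega> \<le> c) \<and> (\<forall>k\<in>{1..n}. E (X k) \<ge> 0)
        \<and> (\<Sum>k=1..n. E (X k)) > 0"
    then have c: "\<And>k \<omega>. k \<in> {1..n} \<Longrightarrow> \<omega> \<in> space M \<Longrightarrow> X k \<omega> \<le> c"
      and E0: "\<And>k. k \<in> {1..n} \<Longrightarrow> E (X k) \<ge> 0" and pos: "(\<Sum>k=1..n. E (X k)) > 0" by auto
    define e where "e k = real_of_ereal (E (X k))" for k
    have e: "E (X k) = ereal (e k)" if "k \<in> {1..n}" for k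
      using E_le_const[OF H[OF that] c[OF that]] E0[OF that]
      unfolding e_def by (cases "E (X k)") auto
    have e0: "e k \<ge> 0" if "k \<in> {1..n}" for k using E0[OF that] e[OF that] by simp
    have se: "(\<Sum>k=1..n. E (X k)) = ereal (\<Sum>k=1..n. e k)"
      unfolding sum_ereal[symmetric] by (intro sum.cong e) auto
    have e_pos: "(\<Sum>k=1..n. e k) > 0" using pos unfolding se by simp
    let ?h = "\<lambda>x. 1 - (x + c) / (\<Sum>k=1..n. e k)"
    have "ereal (1 - (x + c) / (\<Sum>k=1..n. e k))
      \<le> upper_capacity M H E {\<omega> \<in> space M. Max ((\<lambda>k. S k \<omega>) ` {1..n}) > x}"
    proof (rule ereal_le_if_le_right[where h = "?h"])
      show "isCont ?h x"
        using e_pos by (intro continuous_intros) auto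
    qed (rule capacity_ge_one_sided[OF indep S_def c e e0 e_pos x])
    then show "upper_capacity M H E {\<omega> \<in> space M. Max ((\<lambda>k. S k \<omega>) ` {1..n}) > x}
           \<ge> 1 - ereal (x + c) / (\<Sum>k=1..n. E (X k))"
      unfolding se using e_pos by (simp add: one_ereal_def)
  }
qed

end
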